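(* Let (S) denote the Hamiltonian system $\frac{dx}{dt}=\frac{\partial H}{\partial y}$, $\frac{dy}{dt}=-\frac{\partial H}{\partial x}$, $\frac{dz}{dt}=\frac{\partial H}{\partial w}$, $\frac{dw}{dt}=-\frac{\partial H}{\partial z}$ with polynomial Hamiltonian \begin{align*} H=&\ H_{VI}(x,y,t;\alpha_0,\alpha_1,\alpha_2,\alpha_3+\alpha_5+2\alpha_6,\alpha_3+2\alpha_4+\alpha_5)\\ &+\tilde H_{VI}(z,w,t;\alpha_0+\alpha_3,\alpha_1+2\alpha_2+\alpha_3,\alpha_4,\alpha_5+2\alpha_6,\alpha_5)+\frac{2(x-t)y(z-1)w}{t(t-1)}, \end{align*} where $\alpha_0,\dots,\alpha_6\in\mathbb{C}$ satisfy $\alpha_0+\alpha_1+2\alpha_2+2\alpha_3+2\alpha_4+2\alpha_5+2\alpha_6=1$. Then (S) admits extended affine Weyl group symmetry of type $B_6^{(1)}$ as the group of its Bäcklund transformations, whose generators $w_0,\dots,w_6,\psi$ are given as follows, with $( * )=(x,y,z,w,t;\alpha_0,\dots,\alpha_6)$: \begin{align*} w_0:( * )&\to\left(x,y-\tfrac{\alpha_0}{x-t},z,w,t;-\alpha_0,\alpha_1,\alpha_2+\alpha_0,\alpha_3,\alpha_4,\alpha_5,\alpha_6\right),\\ w_1:( * )&\to(x,y,z,w,t;\alpha_0,-\alpha_1,\alpha_2+\alpha_1,\alpha_3,\alpha_4,\alpha_5,\alpha_6),\\ w_2:( * )&\to\left(x+\tfrac{\alpha_2}{y},y,z,w,t;\alpha_0+\alpha_2,\alpha_1+\alpha_2,-\alpha_2,\alpha_3+\alpha_2,\alpha_4,\alpha_5,\alpha_6\right),\\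 w_3:( * )&\to\left(x,y-\tfrac{\alpha_3z}{xz-1},z,w-\tfrac{\alpha_3x}{xz-1},t;\alpha_0,\alpha_1,\alpha_2+\alpha_3,-\alpha_3,\alpha_4+\alpha_3,\alpha_5,\alpha_6\right),\\ w_4:( * )&\to\left(x,y,z+\tfrac{\alpha_4}{w},w,t;\alpha_0,\alpha_1,\alpha_2,\alpha_3+\alpha_4,-\alpha_4,\alpha_5+\alpha_4,\alpha_6\right),\\ w_5:( * )&\to(x,y,z,w,t;\alpha_0,\alpha_1,\alpha_2,\alpha_3,\alpha_4+\alpha_5,-\alpha_5,\alpha_6+\alpha_5),\\ w_6:( * )&\to\Big(1-x,-y,\tfrac{z}{z-1},-(z-1)\{(z-1)w+\alpha_4\},1-t;\alpha_0,\alpha_1,\alpha_2,\alpha_3,\alpha_4,\alpha_5+2\alpha_6,-\alpha_6\Big),\\ \psi:( * )&\to\Big(\tfrac{(t-1)x}{t-x},\tfrac{(t-x)\{(t-x)y-\alpha_2\}}{t(t-1)},\tfrac{tz-1}{t-1},\tfrac{(t-1)w}{t},1-t;\alpha_1,\alpha_0,\alpha_2,\alpha_3,\alpha_4,\alpha_5,\alpha_6\Big). \end{align*}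
   Context: For parameters with $\delta_0+\delta_1+2\delta_2+\delta_3+\delta_4=1$, $$H_{VI}(q,p,t;\delta_0,\dots,\delta_4)=\tfrac{1}{t(t-1)}\big[p^2(q-t)(q-1)q-\{(\delta_0-1)(q-1)q+\delta_3(q-t)q+\delta_4(q-t)(q-1)\}p+\delta_2(\delta_1+\delta_2)q\big],$$ $$\tilde H_{VI}(Q,P,t;\delta_0,\dots,\delta_4)=\tfrac{1}{t(t-1)}\big[P^2(tQ-1)(Q-1)Q-\{(\delta_0-1)t(Q-1)Q+\delta_1(Q-1)(tQ-1)+\delta_3Q(tQ-1)\}P+\delta_2(\delta_2+\delta_4)tQ\big].$$ A Bäcklund transformation is a birational change of $(x,y,z,w,t)$ (depending on the parameters) together with a change of parameters that carries the system with the old parameters into the system with the new parameters (in the new variables, with the new independent variable). Transformations are composed as substitution automorphisms of the field of rational functions in $x,y,z,w,t$ and the parameters. "Extended affine Weyl group symmetry of type $B_6^{(1)}$" means: all the transformations are Bäcklund transformations; $w_i^2=1$ and $(w_iw_j)^{m_{ij}}=1$ with $m_{56}=4$, $m_{02}=m_{12}=m_{23}=m_{34}=m_{45}=3$ and $m_{ij}=2$ for other pairs $i\neq j$ (Dynkin diagram of type $B_6^{(1)}$); and $\psi$ acts as the diagram automorphism: $\psi^2=1$ and conjugation by $\psi$ exchanges $w_0$ and $w_1$ and fixes the other $w_i$. *)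

theory Defs
  imports
    "HOL-Analysis.Analysis"
    "HOL-Library.Poly_Mapping"
    "HOL-Computational_Algebra.Fraction_Field"
begin

section \<open>The Hamiltonian system\<close>

definition H_VI ::
  "complex \<Rightarrow> complex \<Rightarrow> complex \<Rightarrow> complex \<Rightarrow> complex \<Rightarrow> complex \<Rightarrow> complex \<Rightarrow> complex \<Rightarrow> complex" where
  "H_VI q p t \<delta>0 \<delta>1 \<delta>2 \<delta>3 \<delta>4 =
     1 / (t * (t - 1)) *
     (p\<^sup>2 * (q - t) * (q - 1) * q
      - ((\<delta>0 - 1) * (q - 1) * q + \<delta>3 * (q - t) * q + \<delta>4 * (q - t) * (q - 1)) * p
      + \<delta>2 * (\<delta>1 + \<delta>2) * q)"

definition H_VI_tilde ::
  "complex \<Rightarrow> complex \<Rightarrow> complex \<Rightarrow> complex \<Rightarrow> complex \<Rightarrow> complex \<Rightarrow> complex \<Rightarrow> complex \<Rightarrow> complex" where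
  "H_VI_tilde Q P t \<delta>0 \<delta>1 \<delta>2 \<delta>3 \<delta>4 =
     1 / (t * (t - 1)) *
     (P\<^sup>2 * (t * Q - 1) * (Q - 1) * Q
      - ((\<delta>0 - 1) * t * (Q - 1) * Q + \<delta>1 * (Q - 1) * (t * Q - 1) + \<delta>3 * Q * (t * Q - 1)) * P
      + \<delta>2 * (\<delta>2 + \<delta>4) * t * Q)"

text \<open>A parameter vector is a function on indices, of which only the values at 0, ..., 6 are used.\<close>

definition Ham ::
  "(nat \<Rightarrow> complex) \<Rightarrow> complex \<Rightarrow> complex \<Rightarrow> complex \<Rightarrow> complex \<Rightarrow> complex \<Rightarrow> complex" where
  "Ham \<alpha> x y z w t =
     H_VI x y t (\<alpha> 0) (\<alpha> 1) (\<alpha> 2) (\<alpha> 3 + \<alpha> 5 + 2 * \<alpha> 6) (\<alpha> 3 + 2 * \<alpha> 4 + \<alpha> 5)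
   + H_VI_tilde z w t (\<alpha> 0 + \<alpha> 3) (\<alpha> 1 + 2 * \<alpha> 2 + \<alpha> 3) (\<alpha> 4) (\<alpha> 5 + 2 * \<alpha> 6) (\<alpha> 5)
   + 2 * (x - t) * y * (z - 1) * w / (t * (t - 1))"

definition normalized :: "(nat \<Rightarrow> complex) \<Rightarrow> bool" where
  "normalized \<alpha> \<longleftrightarrow>
     \<alpha> 0 + \<alpha> 1 + 2 * \<alpha> 2 + 2 * \<alpha> 3 + 2 * \<alpha> 4 + 2 * \<alpha> 5 + 2 * \<alpha> 6 = 1"

definition solves ::
  "(nat \<Rightarrow> complex) \<Rightarrow> complex set \<Rightarrow> (complex \<Rightarrow> complex) \<Rightarrow> (complex \<Rightarrow> complex) \<Rightarrow>
   (complex \<Rightarrow> complex) \<Rightarrow> (complex \<Rightarrow> complex) \<Rightarrow> bool" where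
  "solves \<alpha> U x y z w \<longleftrightarrow> (\<forall>t\<in>U.
     (x has_field_derivative deriv (\<lambda>v. Ham \<alpha> (x t) v (z t) (w t) t) (y t)) (at t) \<and>
     (y has_field_derivative - deriv (\<lambda>v. Ham \<alpha> v (y t) (z t) (w t) t) (x t)) (at t) \<and>
     (z has_field_derivative deriv (\<lambda>v. Ham \<alpha> (x t) (y t) (z t) v t) (w t)) (at t) \<and>
     (w has_field_derivative - deriv (\<lambda>v. Ham \<alpha> (x t) (y t) v (w t) t) (z t)) (at t))"


section \<open>The field of rational functions in the variables and the parameters\<close>

text \<open>
  The parameters live on the hyperplane cut out by the normalization, so its function field is
  purely transcendental over the complex numbers. We take the coordinates 1, ..., 6 as
  indeterminates; coordinate 0 is the affine function of the others given by the normalization.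
\<close>

datatype indet = Vx | Vy | Vz | Vw | Vt | Va1 | Va2 | Va3 | Va4 | Va5 | Va6

text \<open>
  The linear order is irrelevant to the mathematics. It is needed because the library's proof that
  polynomials form an integral domain assumes linearly ordered exponents.
\<close>

fun indet_index :: "indet \<Rightarrow> nat" where
  "indet_index Vx = 0" | "indet_index Vy = 1" | "indet_index Vz = 2" | "indet_index Vw = 3"
| "indet_index Vt = 4" | "indet_index Va1 = 5" | "indet_index Va2 = 6" | "indet_index Va3 = 7"
| "indet_index Va4 = 8" | "indet_index Va5 = 9" | "indet_index Va6 = 10"

lemma indet_index_inj: "indet_index u = indet_index v \<Longrightarrow> u = v"
  by (cases u; cases v; simp)

instantiation indet :: linorder
begin

definition less_eq_indet :: "indet \<Rightarrow> indet \<Rightarrow> bool" where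
  "less_eq_indet u v \<longleftrightarrow> indet_index u \<le> indet_index v"

definition less_indet :: "indet \<Rightarrow> indet \<Rightarrow> bool" where
  "less_indet u v \<longleftrightarrow> indet_index u < indet_index v"

instance
  by standard (auto simp: less_eq_indet_def less_indet_def intro: indet_index_inj)

end

type_synonym mpoly = "(indet \<Rightarrow>\<^sub>0 nat) \<Rightarrow>\<^sub>0 complex"
type_synonym ratfun = "mpoly fract"

definition const :: "complex \<Rightarrow> ratfun" where
  "const c = Fract (Poly_Mapping.single 0 c) 1"

definition indet :: "indet \<Rightarrow> ratfun" where
  "indet v = Fract (Poly_Mapping.single (Poly_Mapping.single v 1) 1) 1"

definition \<x> :: ratfun where "\<x> = indet Vx"
definition \<y> :: ratfun where "\<y> = indet Vy"
definition \<z> :: ratfun where "\<z> = indet Vz"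
definition \<w> :: ratfun where "\<w> = indet Vw"
definition \<t> :: ratfun where "\<t> = indet Vt"

definition \<a>0 :: ratfun where
  "\<a>0 = 1 - (indet Va1 + 2 * indet Va2 + 2 * indet Va3 + 2 * indet Va4 + 2 * indet Va5
            + 2 * indet Va6)"
definition \<a>1 :: ratfun where "\<a>1 = indet Va1"
definition \<a>2 :: ratfun where "\<a>2 = indet Va2"
definition \<a>3 :: ratfun where "\<a>3 = indet Va3"
definition \<a>4 :: ratfun where "\<a>4 = indet Va4"
definition \<a>5 :: ratfun where "\<a>5 = indet Va5"
definition \<a>6 :: ratfun where "\<a>6 = indet Va6"

definition params :: "ratfun list" where
  "params = [\<a>0, \<a>1, \<a>2, \<a>3, \<a>4, \<a>5, \<a>6]"

definition poly_indets :: "mpoly \<Rightarrow> indet set" where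
  "poly_indets f = (\<Union>m\<in>Poly_Mapping.keys f. Poly_Mapping.keys m)"

definition param_field :: "ratfun set" where
  "param_field = {Fract a b | a b. b \<noteq> 0 \<and>
     poly_indets a \<subseteq> {Va1, Va2, Va3, Va4, Va5, Va6} \<and>
     poly_indets b \<subseteq> {Va1, Va2, Va3, Va4, Va5, Va6}}"


section \<open>Values of rational functions\<close>

definition poly_eval :: "(indet \<Rightarrow> complex) \<Rightarrow> mpoly \<Rightarrow> complex" where
  "poly_eval P f =
     (\<Sum>m\<in>Poly_Mapping.keys f. Poly_Mapping.lookup f m *
        (\<Prod>v\<in>Poly_Mapping.keys m. P v ^ Poly_Mapping.lookup m v))"

text \<open>The rational function \<open>f\<close> is regular at the point \<open>P\<close>, with value \<open>c\<close> there.\<close>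

definition has_value :: "ratfun \<Rightarrow> (indet \<Rightarrow> complex) \<Rightarrow> complex \<Rightarrow> bool" where
  "has_value f P c \<longleftrightarrow>
     (\<exists>a b. f = Fract a b \<and> poly_eval P b \<noteq> 0 \<and> c = poly_eval P a / poly_eval P b)"

fun point ::
  "(nat \<Rightarrow> complex) \<Rightarrow> complex \<Rightarrow> complex \<Rightarrow> complex \<Rightarrow> complex \<Rightarrow> complex \<Rightarrow> indet \<Rightarrow> complex" where
  "point \<alpha> x y z w t Vx = x"
| "point \<alpha> x y z w t Vy = y"
| "point \<alpha> x y z w t Vz = z"
| "point \<alpha> x y z w t Vw = w"
| "point \<alpha> x y z w t Vt = t"
| "point \<alpha> x y z w t Va1 = \<alpha> 1"
| "point \<alpha> x y z w t Va2 = \<alpha> 2"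
| "point \<alpha> x y z w t Va3 = \<alpha> 3"
| "point \<alpha> x y z w t Va4 = \<alpha> 4"
| "point \<alpha> x y z w t Va5 = \<alpha> 5"
| "point \<alpha> x y z w t Va6 = \<alpha> 6"


section \<open>Baecklund transformations\<close>

definition field_automorphism :: "(ratfun \<Rightarrow> ratfun) \<Rightarrow> bool" where
  "field_automorphism \<sigma> \<longleftrightarrow>
     bij \<sigma> \<and> (\<forall>f g. \<sigma> (f + g) = \<sigma> f + \<sigma> g) \<and> (\<forall>f g. \<sigma> (f * g) = \<sigma> f * \<sigma> g) \<and>
     (\<forall>c. \<sigma> (const c) = const c)"

text \<open>
  The transformation sending \<open>(x, y, z, w, t; \<alpha>)\<close> to \<open>(X, Y, Z, W, T; A)\<close> is identified with the
  substitution automorphism of the rational function field for which \<open>images\<close> is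
  \<open>([X, Y, Z, W, T], A)\<close>.
\<close>

definition images :: "(ratfun \<Rightarrow> ratfun) \<Rightarrow> ratfun list \<times> ratfun list" where
  "images \<sigma> = (map \<sigma> [\<x>, \<y>, \<z>, \<w>, \<t>], map \<sigma> params)"

text \<open>
  In the definition below \<open>T\<close> is the new independent variable as a function of the old one along
  the given solution, and the new dependent variables \<open>x', y', z', w'\<close> are functions of the new
  independent variable. Injectivity of \<open>T\<close> says that it can serve as a coordinate on \<open>U\<close>. The
  values 0 and 1 of either independent variable are excluded because the system is singular there.
\<close>

definition baecklund :: "(ratfun \<Rightarrow> ratfun) \<Rightarrow> bool" where
  "baecklund \<sigma> \<longleftrightarrow>
     field_automorphism \<sigma> \<and> \<sigma> ` set params \<subseteq> param_field \<and>
     (\<forall>\<alpha> \<alpha>' U T x y z w x' y' z' w'.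
        normalized \<alpha> \<and> open U \<and> 0 \<notin> U \<and> 1 \<notin> U \<and> solves \<alpha> U x y z w \<and>
        inj_on T U \<and> 0 \<notin> T ` U \<and> 1 \<notin> T ` U \<and>
        (\<forall>s\<in>U. let P = point \<alpha> (x s) (y s) (z s) (w s) s in
           has_value (\<sigma> \<x>) P (x' (T s)) \<and>
           has_value (\<sigma> \<y>) P (y' (T s)) \<and>
           has_value (\<sigma> \<z>) P (z' (T s)) \<and>
           has_value (\<sigma> \<w>) P (w' (T s)) \<and>
           has_value (\<sigma> \<t>) P (T s) \<and>
           (\<forall>i\<le>6. has_value (\<sigma> (params ! i)) P (\<alpha>' i)))
        \<longrightarrow> solves \<alpha>' (T ` U) x' y' z' w')"


section \<open>The Coxeter matrix\<close>

text \<open>Only the off-diagonal entries with indices at most 6 are meaningful.\<close>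

definition coxeter_B6 :: "nat \<Rightarrow> nat \<Rightarrow> nat" where
  "coxeter_B6 i j =
     (if {i, j} = {5, 6} then 4
      else if {i, j} \<in> {{0, 2}, {1, 2}, {2, 3}, {3, 4}, {4, 5}} then 3
      else 2)"

end

theory Submission
  imports Defs
begin

text \<open>
  All transformations are involutions, so each substitution endomorphism of the polynomial ring is
  injective and extends to an automorphism of the rational function field; relations between them
  only have to be compared on the variables. For the Baecklund property, the parameter entering a
  transformation is written as \<open>u\<close> times the denominator, which turns the invariance of the
  vector field into polynomial identities. Along a solution the denominators cannot vanish,
  because the new coordinates are required to be regular rational functions at every point.
\<close>

section \<open>Evaluation and substitution\<close>

text \<open>A fraction has no preferred numerator and denominator, and the denominator of one
  representation may vanish where that of another does not. Values are therefore a relation,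
  \<open>fract_val\<close>, which asks for some representation with nonvanishing denominator; cross
  multiplication makes the value unique. Point evaluation and substitution are both instances, so
  one set of rules computes both. The relational form also breaks a circle: that \<open>g\<close>
  applied to its own images returns the variables can be checked before substitution is known to be
  defined on the whole field, and this check is what proves that it is.

  Since \<open>\<a>0\<close> is not an indeterminate, its image is always a consequence of the
  images of the other six parameters.

  On the analytic side the new independent variable is always \<open>t\<close> or
  \<open>1 - t\<close>, and \<open>t * (t - 1)\<close> is invariant under this change. The singular
  factor of the Hamiltonian is thus the same in the old and the new system and can be cleared from
  both.\<close>

lemma poly_mapping_sum_single:
  fixes f :: "'a \<Rightarrow>\<^sub>0 'b::comm_monoid_add"
  shows "f = (\<Sum>m\<in>Poly_Mapping.keys f. Poly_Mapping.single m (Poly_Mapping.lookup f m))"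
proof (rule poly_mapping_eqI)
  fix k
  show "Poly_Mapping.lookup f k =
    Poly_Mapping.lookup (\<Sum>m\<in>Poly_Mapping.keys f. Poly_Mapping.single m (Poly_Mapping.lookup f m)) k"
    by (auto simp: lookup_sum lookup_single when_def in_keys_iff)
qed

lemma single_one_power:
  "Poly_Mapping.single (Poly_Mapping.single v (1::nat)) (1::'b::comm_semiring_1) ^ n
   = Poly_Mapping.single (Poly_Mapping.single v n) 1"
  by (induction n) (simp_all add: mult_single flip: single_add single_one)

text \<open>Exponents add where monomials multiply. With \<open>poly_mapping_sum_single\<close>
  applied to the exponent, this splits a monomial into powers of variables.\<close>

lemma single_sum_one:
  fixes n :: "'v \<Rightarrow> nat"
  assumes "finite A"
  shows "Poly_Mapping.single (\<Sum>v\<in>A. Poly_Mapping.single v (n v)) (1::'b::comm_semiring_1)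
    = (\<Prod>v\<in>A. Poly_Mapping.single (Poly_Mapping.single v 1) 1 ^ n v)"
  using assms
proof induction
  case (insert v A)
  have "Poly_Mapping.single (\<Sum>v\<in>insert v A. Poly_Mapping.single v (n v)) (1::'b) =
    Poly_Mapping.single (Poly_Mapping.single v (n v)) 1 *
    Poly_Mapping.single (\<Sum>v\<in>A. Poly_Mapping.single v (n v)) 1"
    using insert.hyps by (simp add: mult_single)
  then show ?case
    by (simp only: insert.IH prod.insert[OF insert.hyps] single_one_power)
qed simp

text \<open>Constants and variables generate the polynomial ring: a polynomial is a finite sum of
  constants times products of powers of variables. Statements about substitution can thus be checked
  on generators.\<close>

lemma poly_induct [case_names const var add mult]:
  fixes p :: "('v \<Rightarrow>\<^sub>0 nat) \<Rightarrow>\<^sub>0 'k::comm_semiring_1"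
  assumes const: "\<And>c. P (Poly_Mapping.single 0 c)"
    and var: "\<And>v. P (Poly_Mapping.single (Poly_Mapping.single v 1) 1)"
    and add: "\<And>p q. P p \<Longrightarrow> P q \<Longrightarrow> P (p + q)"
    and mult: "\<And>p q. P p \<Longrightarrow> P q \<Longrightarrow> P (p * q)"
  shows "P p"
proof -
  have one: "P 1" using const[of 1] by simp
  have zero: "P 0" using const[of 0] by simp
  have pow: "P q \<Longrightarrow> P (q ^ n)" for q n
    by (induction n) (auto intro: one mult)
  have prod: "(\<And>a. a \<in> A \<Longrightarrow> P (f a)) \<Longrightarrow> P (prod f A)" for f :: "'v \<Rightarrow> _" and A
    by (induction A rule: infinite_finite_induct) (auto intro: one mult)
  have sum: "(\<And>a. a \<in> A \<Longrightarrow> P (f a)) \<Longrightarrow> P (sum f A)" for f :: "('v \<Rightarrow>\<^sub>0 nat) \<Rightarrow> _" and A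
    by (induction A rule: infinite_finite_induct) (auto intro: zero add)
  have mono: "P (Poly_Mapping.single m 1)" for m :: "'v \<Rightarrow>\<^sub>0 nat"
  proof -
    have "Poly_Mapping.single m (1::'k) =
      (\<Prod>v\<in>Poly_Mapping.keys m. Poly_Mapping.single (Poly_Mapping.single v 1) 1 ^ Poly_Mapping.lookup m v)"
      by (subst (1) poly_mapping_sum_single[of m]) (simp only: single_sum_one finite_keys)
    then show ?thesis by (auto intro!: prod pow var[unfolded One_nat_def])
  qed
  have "P (Poly_Mapping.single m c)" for m c
  proof -
    have "Poly_Mapping.single m c = Poly_Mapping.single 0 c * Poly_Mapping.single m 1"
      by (simp add: mult_single)
    then show ?thesis by (simp add: mult const mono)
  qed
  then show ?thesis
    by (subst poly_mapping_sum_single) (rule sum)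
qed

definition peval ::
  "('k::comm_ring_1 \<Rightarrow> 'a::comm_ring_1) \<Rightarrow> ('v \<Rightarrow> 'a) \<Rightarrow> (('v \<Rightarrow>\<^sub>0 nat) \<Rightarrow>\<^sub>0 'k) \<Rightarrow> 'a" where
  "peval h g f = (\<Sum>m\<in>Poly_Mapping.keys f. h (Poly_Mapping.lookup f m) *
     (\<Prod>v\<in>Poly_Mapping.keys m. g v ^ Poly_Mapping.lookup m v))"

text \<open>Regularity of a quotient of polynomials and its value there. Evaluation at a point is
  the case \<open>h = id\<close>, substitution of rational functions for the variables the case
  \<open>h = const\<close>.\<close>

definition fract_val ::
  "('k::idom \<Rightarrow> 'a::field) \<Rightarrow> ('v::linorder \<Rightarrow> 'a) \<Rightarrow> (('v \<Rightarrow>\<^sub>0 nat) \<Rightarrow>\<^sub>0 'k) fract \<Rightarrow> 'a \<Rightarrow> bool" where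
  "fract_val h g f r \<longleftrightarrow>
     (\<exists>a b. f = Fract a b \<and> peval h g b \<noteq> 0 \<and> r = peval h g a / peval h g b)"

text \<open>The kernel of \<open>peval h g\<close> is left arbitrary; for evaluation it contains all
  polynomials vanishing at the point. Nonvanishing of denominators is recorded in
  \<open>fract_val\<close> instead.\<close>

locale coefficient_hom =
  fixes h :: "'k::idom \<Rightarrow> 'a::field"
  assumes hom_add: "h (a + b) = h a + h b"
    and hom_mult: "h (a * b) = h a * h b"
    and hom_one: "h 1 = 1"
begin

lemma hom_zero: "h 0 = 0"
  using hom_add[of 0 0] by (metis add_0 add_left_cancel add.right_neutral)

text \<open>Coefficients may cancel in a sum, so the keys of \<open>p + q\<close> can be fewer than
  those of \<open>p\<close> and \<open>q\<close> together. Summing over a common larger set, where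
  the additional terms are zero, avoids the case distinction.\<close>

lemma peval_superset:
  assumes "finite A" "Poly_Mapping.keys f \<subseteq> A"
  shows "peval h g f = (\<Sum>m\<in>A. h (Poly_Mapping.lookup f m) *
     (\<Prod>v\<in>Poly_Mapping.keys m. g v ^ Poly_Mapping.lookup m v))"
  unfolding peval_def
  by (rule sum.mono_neutral_left) (use assms in \<open>auto simp: in_keys_iff hom_zero\<close>)

lemma peval_add: "peval h g (p + q) = peval h g p + peval h g q"
proof -
  let ?A = "Poly_Mapping.keys p \<union> Poly_Mapping.keys q"
  show ?thesis
    by (subst (1 2 3) peval_superset[of ?A])
      (use keys_add[of p q] in \<open>auto simp: lookup_add hom_add distrib_right sum.distrib\<close>)
qed

lemma peval_zero [simp]: "peval h g 0 = 0"
  by (simp add: peval_def)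

lemma peval_sum: "peval h g (sum f A) = (\<Sum>i\<in>A. peval h g (f i))"
  by (induction A rule: infinite_finite_induct) (auto simp: peval_add)

lemma peval_single:
  "peval h g (Poly_Mapping.single m c) =
     h c * (\<Prod>v\<in>Poly_Mapping.keys m. g v ^ Poly_Mapping.lookup m v)"
  by (subst peval_superset[of "{m}"]) auto

lemma monomial_add:
  "(\<Prod>v\<in>Poly_Mapping.keys (m + n). (g v :: 'a) ^ Poly_Mapping.lookup (m + n) v) =
   (\<Prod>v\<in>Poly_Mapping.keys m. g v ^ Poly_Mapping.lookup m v) *
   (\<Prod>v\<in>Poly_Mapping.keys n. g v ^ Poly_Mapping.lookup n v)"
proof -
  let ?A = "Poly_Mapping.keys m \<union> Poly_Mapping.keys n"
  have *: "(\<Prod>v\<in>Poly_Mapping.keys k. g v ^ Poly_Mapping.lookup k v) =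
    (\<Prod>v\<in>?A. g v ^ Poly_Mapping.lookup k v)" if "Poly_Mapping.keys k \<subseteq> ?A" for k
    by (rule prod.mono_neutral_left) (use that in \<open>auto simp: in_keys_iff\<close>)
  show ?thesis
    unfolding *[OF keys_add] *[OF Un_upper1] *[OF Un_upper2]
    by (simp add: lookup_add power_add prod.distrib)
qed

text \<open>Both sides are bilinear, so products of single terms suffice; there the claim is
  \<open>hom_mult\<close> with \<open>monomial_add\<close>.\<close>

lemma peval_mult: "peval h g (p * q) = peval h g p * peval h g q"
proof -
  let ?s = "\<lambda>f m. Poly_Mapping.single m (Poly_Mapping.lookup f m)"
  have "p * q = (\<Sum>m\<in>Poly_Mapping.keys p. ?s p m) * (\<Sum>n\<in>Poly_Mapping.keys q. ?s q n)"
    by (simp flip: poly_mapping_sum_single)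
  also have "\<dots> = (\<Sum>m\<in>Poly_Mapping.keys p. \<Sum>n\<in>Poly_Mapping.keys q. ?s p m * ?s q n)"
    by (rule sum_product)
  finally have "peval h g (p * q) =
      (\<Sum>m\<in>Poly_Mapping.keys p. \<Sum>n\<in>Poly_Mapping.keys q. peval h g (?s p m) * peval h g (?s q n))"
    by (simp add: peval_sum mult_single peval_single monomial_add hom_mult mult_ac)
  also have "\<dots> =
    peval h g (\<Sum>m\<in>Poly_Mapping.keys p. ?s p m) * peval h g (\<Sum>n\<in>Poly_Mapping.keys q. ?s q n)"
    by (simp only: sum_product peval_sum)
  finally show ?thesis
    by (simp flip: poly_mapping_sum_single)
qed

lemma peval_one [simp]: "peval h g 1 = 1"
  using peval_single[of g 0 1] by (simp add: hom_one)

lemma peval_const: "peval h g (Poly_Mapping.single 0 c) = h c"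
  by (simp add: peval_single)

lemma peval_var: "peval h g (Poly_Mapping.single (Poly_Mapping.single v 1) 1) = g v"
  by (simp add: peval_single hom_one)

text \<open>Equal fractions satisfy \<open>a * d = c * b\<close>, a polynomial equation that
  \<open>peval h g\<close> preserves; both denominators have nonzero image, so it can be divided out
  again.\<close>

lemma fract_val_unique:
  assumes "fract_val h g f r" "fract_val h g f s"
  shows "r = s"
proof -
  obtain a b where 1: "f = Fract a b" "peval h g b \<noteq> 0" "r = peval h g a / peval h g b"
    using assms(1) by (auto simp: fract_val_def)
  obtain c d where 2: "f = Fract c d" "peval h g d \<noteq> 0" "s = peval h g c / peval h g d"
    using assms(2) by (auto simp: fract_val_def)
  have "b \<noteq> 0" "d \<noteq> 0" using 1 2 by auto
  then have "a * d = c * b" using 1(1) 2(1) by (simp add: eq_fract)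
  then have "peval h g a * peval h g d = peval h g c * peval h g b"
    by (metis peval_mult)
  then show ?thesis using 1(2,3) 2(2,3) by (simp add: frac_eq_eq)
qed

lemma fract_val_poly: "fract_val h g (Fract p 1) (peval h g p)"
  unfolding fract_val_def by (rule exI[of _ p], rule exI[of _ 1]) auto

lemma fract_val_add:
  assumes "fract_val h g f r" "fract_val h g f' r'"
  shows "fract_val h g (f + f') (r + r')"
proof -
  obtain a b where 1: "f = Fract a b" "peval h g b \<noteq> 0" "r = peval h g a / peval h g b"
    using assms(1) by (auto simp: fract_val_def)
  obtain c d where 2: "f' = Fract c d" "peval h g d \<noteq> 0" "r' = peval h g c / peval h g d"
    using assms(2) by (auto simp: fract_val_def)
  have "b \<noteq> 0" "d \<noteq> 0" using 1 2 by auto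
  then show ?thesis unfolding fract_val_def
    by (intro exI[of _ "a * d + c * b"] exI[of _ "b * d"])
      (use 1 2 in \<open>auto simp: peval_add peval_mult add_frac_eq\<close>)
qed

lemma fract_val_mult:
  assumes "fract_val h g f r" "fract_val h g f' r'"
  shows "fract_val h g (f * f') (r * r')"
proof -
  obtain a b where 1: "f = Fract a b" "peval h g b \<noteq> 0" "r = peval h g a / peval h g b"
    using assms(1) by (auto simp: fract_val_def)
  obtain c d where 2: "f' = Fract c d" "peval h g d \<noteq> 0" "r' = peval h g c / peval h g d"
    using assms(2) by (auto simp: fract_val_def)
  show ?thesis unfolding fract_val_def
    by (intro exI[of _ "a * c"] exI[of _ "b * d"]) (use 1 2 in \<open>auto simp: peval_mult\<close>)
qed

lemma fract_val_inverse:
  assumes "fract_val h g f r" "r \<noteq> 0"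
  shows "fract_val h g (inverse f) (inverse r)"
proof -
  obtain a b where 1: "f = Fract a b" "peval h g b \<noteq> 0" "r = peval h g a / peval h g b"
    using assms(1) by (auto simp: fract_val_def)
  show ?thesis unfolding fract_val_def
    by (intro exI[of _ b] exI[of _ a]) (use 1 assms(2) in auto)
qed

lemma fract_val_0: "fract_val h g 0 0"
  using fract_val_poly[of g 0] by (simp add: Zero_fract_def)

lemma fract_val_1: "fract_val h g 1 1"
  using fract_val_poly[of g 1] by (simp add: One_fract_def)

lemma hom_minus_one: "h (- 1) = - 1"
  using hom_add[of 1 "- 1"] by (simp add: hom_one hom_zero eq_neg_iff_add_eq_0 add.commute)

lemma fract_val_const: "fract_val h g (Fract (Poly_Mapping.single 0 c) 1) (h c)"
  using fract_val_poly[of g "Poly_Mapping.single 0 c"] by (simp add: peval_const)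

lemma fract_val_var:
  "fract_val h g (Fract (Poly_Mapping.single (Poly_Mapping.single v 1) 1) 1) (g v)"
  using fract_val_poly[of g "Poly_Mapping.single (Poly_Mapping.single v 1) 1"]
  by (simp only: peval_var)

lemma fract_val_uminus:
  assumes "fract_val h g f r"
  shows "fract_val h g (- f) (- r)"
proof -
  have "fract_val h g (Fract (Poly_Mapping.single 0 (- 1)) 1) (- 1)"
    using fract_val_const[of g "- 1"] by (simp add: hom_minus_one)
  moreover have "Fract (Poly_Mapping.single 0 (- 1)) 1 = (- 1 :: (('b \<Rightarrow>\<^sub>0 nat) \<Rightarrow>\<^sub>0 'k) fract)"
    by (simp add: single_uminus One_fract_def)
  ultimately show ?thesis
    using fract_val_mult[OF _ assms, of "- 1" "- 1"] by simp
qed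

lemma fract_val_diff:
  "fract_val h g f r \<Longrightarrow> fract_val h g f' r' \<Longrightarrow> fract_val h g (f - f') (r - r')"
  using fract_val_add[OF _ fract_val_uminus, of g f r f' r'] by simp

lemma fract_val_divide:
  "fract_val h g f r \<Longrightarrow> fract_val h g f' r' \<Longrightarrow> r' \<noteq> 0 \<Longrightarrow> fract_val h g (f / f') (r / r')"
  using fract_val_mult[OF _ fract_val_inverse, of g f r f' r'] by (simp add: divide_inverse)

lemma fract_val_numeral: "fract_val h g (numeral n) (numeral n)"
  by (induction n)
    (simp_all only: numeral.simps fract_val_1 fract_val_add)

lemmas fract_val_intros = fract_val_add fract_val_mult fract_val_diff fract_val_uminus
  fract_val_0 fract_val_1 fract_val_numeral fract_val_divide

end

interpretation id_hom: coefficient_hom "id :: complex \<Rightarrow> complex"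
  by standard auto

interpretation const_hom: coefficient_hom const
  by standard (auto simp: const_def single_add mult_single One_fract_def)

lemma has_value_iff: "has_value f P c \<longleftrightarrow> fract_val id P f c"
  by (simp add: has_value_def fract_val_def poly_eval_def peval_def)

lemma fract_val_indet_const: "fract_val const g (indet v) (g v)"
"fract_val const g (const c) (const c)"
  unfolding indet_def by (rule const_hom.fract_val_var) (metis const_hom.fract_val_const[of g c] const_def)

lemma has_value_indet: "has_value (indet v) P (P v)"
  unfolding indet_def has_value_iff by (rule id_hom.fract_val_var)

lemmas has_value_unique = id_hom.fract_val_unique[where 'b = indet, folded has_value_iff]

text \<open>The order matters: fact 2 is the product rule and fact 5 the value of zero, both cited
  by number below.\<close>

lemmas has_value_intros = id_hom.fract_val_intros[where 'b =
  indet, folded has_value_iff] has_value_indet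

text \<open>For a general \<open>g\<close> there may be no such \<open>r\<close>, namely if
  \<open>g\<close> annihilates every possible denominator of \<open>f\<close>. For the substitutions
  considered here \<open>subst_val\<close> excludes this.\<close>

definition subst :: "(indet \<Rightarrow> ratfun) \<Rightarrow> ratfun \<Rightarrow> ratfun" where
  "subst g f = (THE r. fract_val const g f r)"

text \<open>If \<open>g\<close>, read as a partial substitution, inverts itself on the variables, then a
  polynomial in its kernel is mapped both to itself and to zero by applying \<open>g\<close> twice.\<close>

locale involutive_images =
  fixes g :: "indet \<Rightarrow> ratfun"
  assumes images_val: "fract_val const g (g v) (indet v)"
begin

lemma peval_val: "fract_val const g (peval const g p) (Fract p 1)"
proof (induction p rule: poly_induct)
  case (const c)
  then show ?case
    by (simp add: const_hom.peval_const fract_val_indet_const flip: const_def)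
next
  case (var v)
  show ?case using images_val[of v] by (simp only: const_hom.peval_var indet_def)
next
  case (add p q)
  then show ?case
    using const_hom.fract_val_add[OF add] by (simp add: const_hom.peval_add)
next
  case (mult p q)
  then show ?case
    using const_hom.fract_val_mult[OF mult] by (simp add: const_hom.peval_mult)
qed

lemma peval_eq_0_iff: "peval const g p = 0 \<longleftrightarrow> p = 0"
proof
  assume "peval const g p = 0"
  then have "Fract p 1 = 0"
    using peval_val[of p] const_hom.fract_val_0 const_hom.fract_val_unique by metis
  then show "p = 0" by (simp add: Zero_fract_def eq_fract)
qed simp

text \<open>By \<open>peval_eq_0_iff\<close> a nonzero denominator keeps a nonzero image, so any
  representation of \<open>f\<close> yields a value.\<close>

lemma subst_val: "fract_val const g f (subst g f)"
proof -
  obtain a b where f: "f = Fract a b" "b \<noteq> 0"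
    by (cases f rule: Fract_cases_nonzero) (auto simp: Zero_fract_def intro: that)
  then have "fract_val const g f (peval const g a / peval const g b)"
    by (auto simp: fract_val_def peval_eq_0_iff)
  then show ?thesis
    unfolding subst_def by (rule theI) (blast intro: const_hom.fract_val_unique \<open>fract_val const g f _\<close>)+
qed

lemma subst_eqI: "fract_val const g f r \<Longrightarrow> subst g f = r"
  using subst_val const_hom.fract_val_unique by blast

lemma subst_add: "subst g (a + b) = subst g a + subst g b"
  and subst_mult: "subst g (a * b) = subst g a * subst g b"
  and subst_const: "subst g (const c) = const c"
  and subst_indet: "subst g (indet v) = g v"
  by (auto intro!: subst_eqI const_hom.fract_val_intros subst_val fract_val_indet_const)

lemma subst_images: "subst g (g v) = indet v"
  by (rule subst_eqI) (rule images_val)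

end

section \<open>Homomorphisms of the rational function field\<close>

locale ratfun_hom =
  fixes \<sigma> :: "ratfun \<Rightarrow> ratfun"
  assumes map_add: "\<sigma> (f + g) = \<sigma> f + \<sigma> g"
    and map_mult: "\<sigma> (f * g) = \<sigma> f * \<sigma> g"
    and map_const: "\<sigma> (const c) = const c"
begin

lemma map_0: "\<sigma> 0 = 0"
  using map_add[of 0 0] by (metis add_0 add_left_cancel add.right_neutral)

lemma map_1: "\<sigma> 1 = 1"
  using map_const[of 1] by (simp add: const_hom.hom_one)

lemma map_uminus: "\<sigma> (- f) = - \<sigma> f"
  using map_add[of f "- f"] by (metis add.right_inverse map_0 minus_unique)

lemma map_diff: "\<sigma> (f - g) = \<sigma> f - \<sigma> g"
  using map_add[of f "- g"] by (simp add: map_uminus)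

lemma map_inverse: "\<sigma> (inverse f) = inverse (\<sigma> f)"
proof (cases "f = 0")
  case False
  then have "\<sigma> f * \<sigma> (inverse f) = 1"
    by (simp add: map_1 flip: map_mult)
  then show ?thesis by (metis inverse_unique)
qed (simp add: map_0)

lemma map_divide: "\<sigma> (f / g) = \<sigma> f / \<sigma> g"
  by (simp add: divide_inverse map_mult map_inverse)

lemma map_numeral: "\<sigma> (numeral n) = numeral n"
  by (induction n) (simp_all only: numeral.simps map_1 map_add)

lemmas map_simps = map_0 map_1 map_numeral map_add map_diff map_uminus map_mult map_divide

end

text \<open>The field is generated over the constants by eleven indeterminates. \<open>\<a>0\<close>
  is missing from the list because it is an affine combination of the other parameters.\<close>

lemma ratfun_hom_eqI:
  assumes "ratfun_hom \<sigma>" "ratfun_hom \<tau>"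
    and eq: "\<sigma> \<x> = \<tau> \<x>" "\<sigma> \<y> = \<tau> \<y>" "\<sigma> \<z> = \<tau> \<z>" "\<sigma> \<w> = \<tau> \<w>" "\<sigma> \<t> = \<tau> \<t>" "\<sigma> \<a>1 = \<tau> \<a>1"
      "\<sigma> \<a>2 = \<tau> \<a>2" "\<sigma> \<a>3 = \<tau> \<a>3" "\<sigma> \<a>4 = \<tau> \<a>4" "\<sigma> \<a>5 = \<tau> \<a>5" "\<sigma> \<a>6 = \<tau> \<a>6"
  shows "\<sigma> = \<tau>"
proof
  interpret \<sigma>: ratfun_hom \<sigma> by fact
  interpret \<tau>: ratfun_hom \<tau> by fact
  have indet: "\<sigma> (indet v) = \<tau> (indet v)" for v
    by (cases v) (use eq in \<open>simp_all add: \<x>_def \<y>_def \<z>_def \<w>_def \<t>_def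
      \<a>1_def \<a>2_def \<a>3_def \<a>4_def \<a>5_def \<a>6_def\<close>)
  have poly: "\<sigma> (Fract p 1) = \<tau> (Fract p 1)" for p
  proof (induction p rule: poly_induct)
    case (const c)
    then show ?case using \<sigma>.map_const \<tau>.map_const by (simp add: const_def)
  next
    case (var v)
    then show ?case using indet[of v] by (simp only: indet_def)
  next
    case (add p q)
    have "Fract (p + q) 1 = Fract p 1 + Fract q 1" by simp
    then show ?case using add by (simp only: \<sigma>.map_add \<tau>.map_add)
  next
    case (mult p q)
    have "Fract (p * q) 1 = Fract p 1 * Fract q 1" by simp
    then show ?case using mult by (simp only: \<sigma>.map_mult \<tau>.map_mult)
  qed
  show "\<sigma> f = \<tau> f" for f
  proof -
    obtain a b where "f = Fract a 1 / Fract b 1"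
      by (cases f) auto
    then show ?thesis by (simp only: \<sigma>.map_divide \<tau>.map_divide poly)
  qed
qed

lemma ratfun_hom_comp: "ratfun_hom \<sigma> \<Longrightarrow> ratfun_hom \<tau> \<Longrightarrow> ratfun_hom (\<sigma> \<circ> \<tau>)"
  by (simp add: ratfun_hom_def)

lemma ratfun_hom_id: "ratfun_hom id"
  by (simp add: ratfun_hom_def)

lemma fract_val_cong: "fract_val h g f r \<Longrightarrow> r = s \<Longrightarrow> fract_val h g f s"
  by simp

lemma has_value_cong: "has_value f P r \<Longrightarrow> r = s \<Longrightarrow> has_value f P s"
  by simp

lemma has_value_nonzero: "has_value f P c \<Longrightarrow> c \<noteq> 0 \<Longrightarrow> f \<noteq> 0"
  using has_value_unique has_value_intros(5) by blast

context involutive_images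
begin

sublocale ratfun_hom "subst g"
  by standard (fact subst_add subst_mult subst_const)+

lemma subst_comp_subst: "subst g \<circ> subst g = id"
  by (rule ratfun_hom_eqI)
    (simp_all add: ratfun_hom_comp ratfun_hom_id ratfun_hom_axioms subst_indet subst_images
      \<x>_def \<y>_def \<z>_def \<w>_def \<t>_def \<a>1_def \<a>2_def \<a>3_def \<a>4_def \<a>5_def \<a>6_def)

lemma field_automorphism_subst: "field_automorphism (subst g)"
  unfolding field_automorphism_def
  using o_bij[OF subst_comp_subst subst_comp_subst] by (auto simp: map_add map_mult map_const)

end

text \<open>The list has eleven entries in the order of \<open>indet_index\<close>: the five
  variables, then parameters 1 to 6. The image of \<open>\<a>0\<close> follows from these by
  \<open>fract_val_assign_a0\<close>.\<close>

definition assign :: "ratfun list \<Rightarrow> indet \<Rightarrow> ratfun" where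
  "assign l v = l ! indet_index v"

lemma fract_val_assign:
  "fract_val const (assign l) \<x> (l ! 0)" "fract_val const (assign l) \<y> (l ! 1)"
  "fract_val const (assign l) \<z> (l ! 2)" "fract_val const (assign l) \<w> (l ! 3)"
  "fract_val const (assign l) \<t> (l ! 4)" "fract_val const (assign l) \<a>1 (l ! 5)"
  "fract_val const (assign l) \<a>2 (l ! 6)" "fract_val const (assign l) \<a>3 (l ! 7)"
  "fract_val const (assign l) \<a>4 (l ! 8)" "fract_val const (assign l) \<a>5 (l ! 9)"
  "fract_val const (assign l) \<a>6 (l ! 10)"
  unfolding \<x>_def \<y>_def \<z>_def \<w>_def \<t>_def \<a>1_def \<a>2_def \<a>3_def \<a>4_def \<a>5_def \<a>6_def
  by (rule fract_val_cong, rule fract_val_indet_const, simp add: assign_def)+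

lemma a0_eq: "\<a>0 = 1 - (\<a>1 + 2 * \<a>2 + 2 * \<a>3 + 2 * \<a>4 + 2 * \<a>5 + 2 * \<a>6)"
  by (simp add: \<a>0_def \<a>1_def \<a>2_def \<a>3_def \<a>4_def \<a>5_def \<a>6_def)

lemma fract_val_assign_a0:
  "fract_val const (assign l) \<a>0
     (1 - (l ! 5 + 2 * l ! 6 + 2 * l ! 7 + 2 * l ! 8 + 2 * l ! 9 + 2 * l ! 10))"
  unfolding a0_eq by (intro const_hom.fract_val_intros fract_val_assign)

lemma involutive_images_assign:
  assumes "list_all2 (fract_val const (assign l)) l [\<x>, \<y>, \<z>, \<w>, \<t>, \<a>1, \<a>2, \<a>3, \<a>4, \<a>5, \<a>6]"
  shows "involutive_images (assign l)"
proof
  fix v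
  have "fract_val const (assign l) (l ! indet_index v)
      ([\<x>, \<y>, \<z>, \<w>, \<t>, \<a>1, \<a>2, \<a>3, \<a>4, \<a>5, \<a>6] ! indet_index v)"
    by (rule list_all2_nthD2[OF assms]) (cases v; simp)
  then show "fract_val const (assign l) (assign l v) (indet v)"
    by (cases v) (simp_all add: assign_def
      \<x>_def \<y>_def \<z>_def \<w>_def \<t>_def \<a>1_def \<a>2_def \<a>3_def \<a>4_def \<a>5_def \<a>6_def)
qed

text \<open>An arbitrary point at which no polynomial shown to be nonzero below vanishes.\<close>

definition generic_point :: "indet \<Rightarrow> complex" where
  "generic_point v = of_nat (Suc (indet_index v)) ^ 2"

lemma has_value_generic:
  "has_value \<x> generic_point 1" "has_value \<y> generic_point 4" "has_value \<z> generic_point 9"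
  "has_value \<w> generic_point 16" "has_value \<t> generic_point 25" "has_value \<a>1 generic_point 36"
  "has_value \<a>2 generic_point 49" "has_value \<a>3 generic_point 64" "has_value \<a>4 generic_point 81"
  "has_value \<a>5 generic_point 100" "has_value \<a>6 generic_point 121"
  unfolding \<x>_def \<y>_def \<z>_def \<w>_def \<t>_def \<a>1_def \<a>2_def \<a>3_def \<a>4_def \<a>5_def \<a>6_def
  by (rule has_value_cong, rule has_value_indet, simp add: generic_point_def)+

text \<open>A rational function with a nonzero value at one point is nonzero, so evaluation at
  \<open>generic_point\<close> replaces any comparison of coefficients.\<close>

lemma nonzero_indets:
  "\<y> \<noteq> 0" "\<w> \<noteq> 0" "\<t> \<noteq> 0" "\<t> - 1 \<noteq> 0" "\<z> - 1 \<noteq> 0" "\<x> - \<t> \<noteq> 0" "\<t> - \<x> \<noteq> 0" "\<x> * \<z> - 1 \<noteq> 0"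
  by (rule has_value_nonzero[where P = generic_point],
      (rule has_value_intros has_value_generic)+, simp)+

lemmas nonzero = nonzero_indets nonzero_indets[unfolded right_minus_eq]

text \<open>The left side is what \<open>\<t> - \<x>\<close> becomes under \<open>im_psi\<close>;
  the factored form makes its nonvanishing visible to the simplifier. \<open>denominator_w6\<close>
  does the same for \<open>\<z> - 1\<close> under \<open>im_w6\<close>.\<close>

lemma denominator_psi: "1 - \<t> - (\<t> - 1) * \<x> / (\<t> - \<x>) = - (\<t> * (\<t> - 1)) / (\<t> - \<x>)"
  by (simp add: nonzero field_simps)

lemma denominator_w6: "\<z> / (\<z> - 1) - 1 = 1 / (\<z> - 1)"
  by (simp add: nonzero field_simps)

section \<open>The generators\<close>

definition "im_w0 = [\<x>, \<y> - \<a>0 / (\<x> - \<t>), \<z>, \<w>, \<t>, \<a>1, \<a>2 + \<a>0, \<a>3, \<a>4, \<a>5, \<a>6]"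
definition "im_w1 = [\<x>, \<y>, \<z>, \<w>, \<t>, - \<a>1, \<a>2 + \<a>1, \<a>3, \<a>4, \<a>5, \<a>6]"
definition "im_w2 = [\<x> + \<a>2 / \<y>, \<y>, \<z>, \<w>, \<t>, \<a>1 + \<a>2, - \<a>2, \<a>3 + \<a>2, \<a>4, \<a>5, \<a>6]"
definition "im_w3 = [\<x>, \<y> - \<a>3 * \<z> / (\<x> * \<z> - 1), \<z>, \<w> - \<a>3 * \<x> / (\<x> * \<z> - 1), \<t>,
  \<a>1, \<a>2 + \<a>3, - \<a>3, \<a>4 + \<a>3, \<a>5, \<a>6]"
definition "im_w4 = [\<x>, \<y>, \<z> + \<a>4 / \<w>, \<w>, \<t>, \<a>1, \<a>2, \<a>3 + \<a>4, - \<a>4, \<a>5 + \<a>4, \<a>6]"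
definition "im_w5 = [\<x>, \<y>, \<z>, \<w>, \<t>, \<a>1, \<a>2, \<a>3, \<a>4 + \<a>5, - \<a>5, \<a>6 + \<a>5]"
definition "im_w6 = [1 - \<x>, - \<y>, \<z> / (\<z> - 1), - ((\<z> - 1) * ((\<z> - 1) * \<w> + \<a>4)), 1 - \<t>,
  \<a>1, \<a>2, \<a>3, \<a>4, \<a>5 + 2 * \<a>6, - \<a>6]"
definition "im_psi = [(\<t> - 1) * \<x> / (\<t> - \<x>), (\<t> - \<x>) * ((\<t> - \<x>) * \<y> - \<a>2) / (\<t> * (\<t> - 1)),
  (\<t> * \<z> - 1) / (\<t> - 1), (\<t> - 1) * \<w> / \<t>, 1 - \<t>, \<a>0, \<a>2, \<a>3, \<a>4, \<a>5, \<a>6]"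

interpretation w0: involutive_images "assign im_w0"
  apply (rule involutive_images_assign)
  \<comment> \<open>Only the list being checked is unfolded; the copy inside \<open>assign\<close>
    stays folded so that \<open>fract_val_assign\<close> still applies.\<close>
  apply (subst (2) im_w0_def)
  apply (simp only: list_all2_Cons list_all2_Nil)
  \<comment> \<open>\<open>fract_val_cong\<close> leaves the value schematic. The introduction rules
    compute it from the shape of each image, the simplifier settles the denominators, and what
    remains is the equation saying that the second application undoes the first.\<close>
  apply (intro conjI refl; rule fract_val_cong,
     (rule const_hom.fract_val_intros fract_val_assign fract_val_assign_a0
       | (simp add: im_w0_def nonzero; fail))+)
  apply (simp_all add: im_w0_def nonzero a0_eq)
  apply (simp_all add: nonzero divide_simps a0_eq)
  done

interpretation w1: involutive_images "assign im_w1"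
  apply (rule involutive_images_assign)
  apply (subst (2) im_w1_def)
  apply (simp only: list_all2_Cons list_all2_Nil)
  apply (intro conjI refl; rule fract_val_cong,
     (rule const_hom.fract_val_intros fract_val_assign fract_val_assign_a0
       | (simp add: im_w1_def nonzero; fail))+)
  done

interpretation w2: involutive_images "assign im_w2"
  apply (rule involutive_images_assign)
  apply (subst (2) im_w2_def)
  apply (simp only: list_all2_Cons list_all2_Nil)
  apply (intro conjI refl; rule fract_val_cong,
     (rule const_hom.fract_val_intros fract_val_assign fract_val_assign_a0
       | (simp add: im_w2_def nonzero; fail))+)
  done

interpretation w3: involutive_images "assign im_w3"
  apply (rule involutive_images_assign)
  apply (subst (2) im_w3_def)
  apply (simp only: list_all2_Cons list_all2_Nil)
  apply (intro conjI refl; rule fract_val_cong,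
     (rule const_hom.fract_val_intros fract_val_assign fract_val_assign_a0
       | (simp add: im_w3_def nonzero; fail))+)
  done

interpretation w4: involutive_images "assign im_w4"
  apply (rule involutive_images_assign)
  apply (subst (2) im_w4_def)
  apply (simp only: list_all2_Cons list_all2_Nil)
  apply (intro conjI refl; rule fract_val_cong,
     (rule const_hom.fract_val_intros fract_val_assign fract_val_assign_a0
       | (simp add: im_w4_def nonzero; fail))+)
  done

interpretation w5: involutive_images "assign im_w5"
  apply (rule involutive_images_assign)
  apply (subst (2) im_w5_def)
  apply (simp only: list_all2_Cons list_all2_Nil)
  apply (intro conjI refl; rule fract_val_cong,
     (rule const_hom.fract_val_intros fract_val_assign fract_val_assign_a0
       | (simp add: im_w5_def nonzero; fail))+)
  done

interpretation w6: involutive_images "assign im_w6"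
  apply (rule involutive_images_assign)
  apply (subst (2) im_w6_def)
  apply (simp only: list_all2_Cons list_all2_Nil)
  apply (intro conjI refl; rule fract_val_cong,
     (rule const_hom.fract_val_intros fract_val_assign fract_val_assign_a0
       | (simp add: im_w6_def nonzero denominator_w6; fail))+)
  done

interpretation psi: involutive_images "assign im_psi"
  apply (rule involutive_images_assign)
  apply (subst (2) im_psi_def)
  apply (simp only: list_all2_Cons list_all2_Nil)
  apply (intro conjI refl; rule fract_val_cong,
     (rule const_hom.fract_val_intros fract_val_assign fract_val_assign_a0
       | (simp add: im_psi_def nonzero denominator_psi; fail))+)
  apply (simp_all add: im_psi_def nonzero a0_eq denominator_psi)
  apply (simp_all add: nonzero divide_simps, (simp_all add: algebra_simps)?)
  done

lemma subst_assign:
  assumes "involutive_images (assign l)"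
  shows "subst (assign l) \<x> = l ! 0" "subst (assign l) \<y> = l ! 1" "subst (assign l) \<z> = l ! 2"
    "subst (assign l) \<w> = l ! 3" "subst (assign l) \<t> = l ! 4" "subst (assign l) \<a>1 = l ! 5"
    "subst (assign l) \<a>2 = l ! 6" "subst (assign l) \<a>3 = l ! 7" "subst (assign l) \<a>4 = l ! 8"
    "subst (assign l) \<a>5 = l ! 9" "subst (assign l) \<a>6 = l ! 10"
    "subst (assign l) \<a>0 = 1 - (l ! 5 + 2 * l ! 6 + 2 * l ! 7 + 2 * l ! 8 + 2 * l ! 9 + 2 * l ! 10)"
  using assms by (simp_all only: involutive_images.subst_eqI fract_val_assign fract_val_assign_a0)

section \<open>The generators as automorphisms, with their images\<close>

definition "W0 = subst (assign im_w0)"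

text \<open>The image of \<open>\<a>0\<close> is forced by the normalization: adding
  \<open>\<a>0\<close> to \<open>\<a>2\<close> lowers \<open>\<a>0\<close> by
  \<open>2 * \<a>0\<close>, which gives \<open>- \<a>0\<close>.\<close>

lemma w0_images:
  "W0 \<x> = \<x>"
  "W0 \<y> = \<y> - \<a>0 / (\<x> - \<t>)"
  "W0 \<z> = \<z>"
  "W0 \<w> = \<w>"
  "W0 \<t> = \<t>"
  "W0 \<a>0 = - \<a>0"
  "W0 \<a>1 = \<a>1"
  "W0 \<a>2 = \<a>2 + \<a>0"
  "W0 \<a>3 = \<a>3"
  "W0 \<a>4 = \<a>4"
  "W0 \<a>5 = \<a>5"
  "W0 \<a>6 = \<a>6"
  unfolding W0_def subst_assign[OF w0.involutive_images_axioms]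
  by (simp_all add: im_w0_def a0_eq)

lemmas w0_simps = w0.map_simps[folded W0_def] w0_images

definition "W1 = subst (assign im_w1)"

lemma w1_images:
  "W1 \<x> = \<x>"
  "W1 \<y> = \<y>"
  "W1 \<z> = \<z>"
  "W1 \<w> = \<w>"
  "W1 \<t> = \<t>"
  "W1 \<a>0 = \<a>0"
  "W1 \<a>1 = - \<a>1"
  "W1 \<a>2 = \<a>2 + \<a>1"
  "W1 \<a>3 = \<a>3"
  "W1 \<a>4 = \<a>4"
  "W1 \<a>5 = \<a>5"
  "W1 \<a>6 = \<a>6"
  unfolding W1_def subst_assign[OF w1.involutive_images_axioms]
  by (simp_all add: im_w1_def a0_eq)

lemmas w1_simps = w1.map_simps[folded W1_def] w1_images

definition "W2 = subst (assign im_w2)"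

lemma w2_images:
  "W2 \<x> = \<x> + \<a>2 / \<y>"
  "W2 \<y> = \<y>"
  "W2 \<z> = \<z>"
  "W2 \<w> = \<w>"
  "W2 \<t> = \<t>"
  "W2 \<a>0 = \<a>0 + \<a>2"
  "W2 \<a>1 = \<a>1 + \<a>2"
  "W2 \<a>2 = - \<a>2"
  "W2 \<a>3 = \<a>3 + \<a>2"
  "W2 \<a>4 = \<a>4"
  "W2 \<a>5 = \<a>5"
  "W2 \<a>6 = \<a>6"
  unfolding W2_def subst_assign[OF w2.involutive_images_axioms]
  by (simp_all add: im_w2_def a0_eq)

lemmas w2_simps = w2.map_simps[folded W2_def] w2_images

definition "W3 = subst (assign im_w3)"

lemma w3_images:
  "W3 \<x> = \<x>"
  "W3 \<y> = \<y> - \<a>3 * \<z> / (\<x> * \<z> - 1)"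
  "W3 \<z> = \<z>"
  "W3 \<w> = \<w> - \<a>3 * \<x> / (\<x> * \<z> - 1)"
  "W3 \<t> = \<t>"
  "W3 \<a>0 = \<a>0"
  "W3 \<a>1 = \<a>1"
  "W3 \<a>2 = \<a>2 + \<a>3"
  "W3 \<a>3 = - \<a>3"
  "W3 \<a>4 = \<a>4 + \<a>3"
  "W3 \<a>5 = \<a>5"
  "W3 \<a>6 = \<a>6"
  unfolding W3_def subst_assign[OF w3.involutive_images_axioms]
  by (simp_all add: im_w3_def a0_eq)

lemmas w3_simps = w3.map_simps[folded W3_def] w3_images

definition "W4 = subst (assign im_w4)"

lemma w4_images:
  "W4 \<x> = \<x>"
  "W4 \<y> = \<y>"
  "W4 \<z> = \<z> + \<a>4 / \<w>"
  "W4 \<w> = \<w>"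
  "W4 \<t> = \<t>"
  "W4 \<a>0 = \<a>0"
  "W4 \<a>1 = \<a>1"
  "W4 \<a>2 = \<a>2"
  "W4 \<a>3 = \<a>3 + \<a>4"
  "W4 \<a>4 = - \<a>4"
  "W4 \<a>5 = \<a>5 + \<a>4"
  "W4 \<a>6 = \<a>6"
  unfolding W4_def subst_assign[OF w4.involutive_images_axioms]
  by (simp_all add: im_w4_def a0_eq)

lemmas w4_simps = w4.map_simps[folded W4_def] w4_images

definition "W5 = subst (assign im_w5)"

lemma w5_images:
  "W5 \<x> = \<x>"
  "W5 \<y> = \<y>"
  "W5 \<z> = \<z>"
  "W5 \<w> = \<w>"
  "W5 \<t> = \<t>"
  "W5 \<a>0 = \<a>0"
  "W5 \<a>1 = \<a>1"
  "W5 \<a>2 = \<a>2"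
  "W5 \<a>3 = \<a>3"
  "W5 \<a>4 = \<a>4 + \<a>5"
  "W5 \<a>5 = - \<a>5"
  "W5 \<a>6 = \<a>6 + \<a>5"
  unfolding W5_def subst_assign[OF w5.involutive_images_axioms]
  by (simp_all add: im_w5_def a0_eq)

lemmas w5_simps = w5.map_simps[folded W5_def] w5_images

definition "W6 = subst (assign im_w6)"

lemma w6_images:
  "W6 \<x> = 1 - \<x>"
  "W6 \<y> = - \<y>"
  "W6 \<z> = \<z> / (\<z> - 1)"
  "W6 \<w> = - ((\<z> - 1) * ((\<z> - 1) * \<w> + \<a>4))"
  "W6 \<t> = 1 - \<t>"
  "W6 \<a>0 = \<a>0"
  "W6 \<a>1 = \<a>1"
  "W6 \<a>2 = \<a>2"
  "W6 \<a>3 = \<a>3"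
  "W6 \<a>4 = \<a>4"
  "W6 \<a>5 = \<a>5 + 2 * \<a>6"
  "W6 \<a>6 = - \<a>6"
  unfolding W6_def subst_assign[OF w6.involutive_images_axioms]
  by (simp_all add: im_w6_def a0_eq)

lemmas w6_simps = w6.map_simps[folded W6_def] w6_images

definition "\<Psi> = subst (assign im_psi)"

lemma psi_images:
  "\<Psi> \<x> = (\<t> - 1) * \<x> / (\<t> - \<x>)"
  "\<Psi> \<y> = (\<t> - \<x>) * ((\<t> - \<x>) * \<y> - \<a>2) / (\<t> * (\<t> - 1))"
  "\<Psi> \<z> = (\<t> * \<z> - 1) / (\<t> - 1)"
  "\<Psi> \<w> = (\<t> - 1) * \<w> / \<t>"
  "\<Psi> \<t> = 1 - \<t>"
  "\<Psi> \<a>0 = \<a>1"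
  "\<Psi> \<a>1 = \<a>0"
  "\<Psi> \<a>2 = \<a>2"
  "\<Psi> \<a>3 = \<a>3"
  "\<Psi> \<a>4 = \<a>4"
  "\<Psi> \<a>5 = \<a>5"
  "\<Psi> \<a>6 = \<a>6"
  unfolding \<Psi>_def subst_assign[OF psi.involutive_images_axioms]
  by (simp_all add: im_psi_def a0_eq)

lemmas psi_simps = psi.map_simps[folded \<Psi>_def] psi_images

section \<open>Relations\<close>

text \<open>One computation for three braid relations. One reflection shifts \<open>x\<close> by
  \<open>b / y\<close>, the other shifts \<open>y\<close> by \<open>a * z / (x * z - c)\<close>; the
  third identity concerns the variable conjugate to \<open>z\<close>. The pair (0, 2) is
  \<open>z = 1\<close>, \<open>c = \<t>\<close>; the pair (2, 3) is \<open>z = \<z>\<close>,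
  \<open>c = 1\<close>; the pair (3, 4) is the same with (\<open>\<x>\<close>, \<open>\<y>\<close>)
  and (\<open>\<z>\<close>, \<open>\<w>\<close>) exchanged.\<close>

lemma braid_identities:
  fixes a b c x y z :: "'a::field"
  assumes "y \<noteq> 0" "x * z - c \<noteq> 0" "y * (x * z - c) - a * z \<noteq> 0" "y * (x * z - c) + b * z \<noteq> 0"
  defines "x' \<equiv> x + b / y" and "y' \<equiv> y - a * z / (x * z - c)"
  defines "x'' \<equiv> x + (a + b) / y'"
  shows "(a + b) / y' = b / y + a / (y - (a + b) * z / (x' * z - c))"
    and "a * z / (x * z - c) + b * z / (x'' * z - c) = (a + b) * z / (x' * z - c)"
    and "a * x / (x * z - c) + b * x'' / (x'' * z - c) = (a + b) * x' / (x' * z - c)"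
proof -
  \<comment> \<open>Every denominator in either word is a quotient of products of \<open>y\<close>,
    \<open>e\<close>, \<open>n\<close> and \<open>m\<close>. Keeping these four opaque until
    fractions are cleared keeps the polynomials small.\<close>
  define e where "e = x * z - c"
  define n where "n = y * e - a * z"
  define m where "m = y * e + b * z"
  have c: "c = x * z - e" by (simp add: e_def)
  have nz: "e \<noteq> 0" "n \<noteq> 0" "m \<noteq> 0" using assms(2-4) by (auto simp: n_def m_def e_def)
  have y': "y' = n / e" using nz by (simp add: y'_def n_def field_simps flip: e_def)
  have x': "x' * z - c = m / y" using assms(1) by (simp add: x'_def c m_def field_simps)
  have yx': "y - (a + b) * z / (m / y) = y * n / m"
    using assms(1) nz by (simp add: m_def n_def field_simps)
  have x'': "x'' * z - c = e * m / n"
    using nz by (simp add: x''_def y' c m_def n_def field_simps)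
  show "(a + b) / y' = b / y + a / (y - (a + b) * z / (x' * z - c))"
    unfolding x' yx' y' using assms(1) nz by (simp add: divide_simps) (simp add: m_def n_def algebra_simps)
  show "a * z / (x * z - c) + b * z / (x'' * z - c) = (a + b) * z / (x' * z - c)"
    unfolding x' x'' e_def[symmetric] using assms(1) nz
    by (simp add: divide_simps) (simp add: m_def n_def algebra_simps)
  show "a * x / (x * z - c) + b * x'' / (x'' * z - c) = (a + b) * x' / (x' * z - c)"
    unfolding x' x'' e_def[symmetric] unfolding x''_def x'_def y' using assms(1) nz
    by (simp add: divide_simps) (simp add: m_def n_def algebra_simps)
qed

text \<open>The equation on \<open>\<x>\<close> for commuting \<open>\<Psi>\<close> with
  \<open>W2\<close>. The only compound denominator, \<open>t - (x + a / y)\<close>, is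
  \<open>n / y\<close>, where \<open>n\<close> is also the factor that appears in the image of
  \<open>\<y>\<close> under \<open>\<Psi>\<close>.\<close>

lemma psi_w2_identity:
  fixes a t x y :: "'a::field"
  assumes "t \<noteq> x" "y \<noteq> 0" "(t - x) * y - a \<noteq> 0"
  shows "(t - 1) * x / (t - x) + a * (t * (t - 1)) / ((t - x) * ((t - x) * y - a)) =
     (t - 1) * (x + a / y) / (t - (x + a / y))"
proof -
  define n where "n = (t - x) * y - a"
  have "t - (x + a / y) = n / y" using assms(2) by (simp add: n_def field_simps)
  then show ?thesis
    using assms unfolding n_def[symmetric]
    by (simp add: divide_simps) (simp add: n_def algebra_simps)
qed

text \<open>The equation on \<open>\<z>\<close> for commuting \<open>W4\<close> with
  \<open>W6\<close>. The image of \<open>\<w>\<close> under \<open>W6\<close> turns into a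
  denominator, whose nontrivial factor is \<open>n\<close>.\<close>

lemma w4_w6_identity:
  fixes a z w :: "'a::field"
  assumes "w \<noteq> 0" "z \<noteq> 1" "(z - 1) * w + a \<noteq> 0"
  shows "(z + a / w) / (z + a / w - 1) = z / (z - 1) - a / ((z - 1) * ((z - 1) * w + a))"
proof -
  define n where "n = (z - 1) * w + a"
  have "z + a / w - 1 = n / w" using assms(1) by (simp add: n_def field_simps)
  then show ?thesis
    using assms unfolding n_def[symmetric]
    by (simp add: divide_simps) (simp add: n_def algebra_simps)
qed

text \<open>The left side is the image of \<open>\<x> * \<z> - 1\<close> under \<open>W6\<close>: up
  to a unit the pole of \<open>W3\<close> is invariant, which makes the two commute. The next two
  lemmas are the analogues for \<open>\<Psi>\<close> with the poles of \<open>W3\<close> and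
  \<open>W6\<close>.\<close>

lemma w3_w6_denominator:
  fixes a x z :: "'a::field"
  assumes "z \<noteq> 1" "x * z \<noteq> 1"
  shows "(1 - x) * z / (z - 1) - 1 = - ((x * z - 1) / (z - 1))"
  using assms by (simp add: field_simps)

lemma psi_w3_denominator:
  fixes t x z :: "'a::field"
  assumes "t \<noteq> x"
  shows "x * (t * z - 1) / (t - x) - 1 = t * (x * z - 1) / (t - x)"
  using assms by (simp add: field_simps)

lemma psi_w6_denominator:
  fixes t x z :: "'a::field"
  assumes "t \<noteq> 1"
  shows "(t * z - 1) / (t - 1) - 1 = t * (z - 1) / (t - 1)"
  using assms by (simp add: field_simps)

lemma has_value_generic_a0: "has_value \<a>0 generic_point (- 865)"
  unfolding a0_eq
  by (rule has_value_cong, (rule has_value_intros has_value_generic)+, simp)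

text \<open>Instances of the hypotheses of \<open>braid_identities\<close>,
  \<open>w4_w6_identity\<close> and \<open>psi_w2_identity\<close>. The factor \<open>* 1\<close> is
  kept so that the case \<open>z = 1\<close> matches literally.\<close>

lemma nonzero_numerators:
  "\<x> * 1 - \<t> \<noteq> 0" "\<y> * (\<x> * 1 - \<t>) - \<a>0 * 1 \<noteq> 0" "\<y> * (\<x> * 1 - \<t>) + \<a>2 * 1 \<noteq> 0"
  "\<y> * (\<x> * \<z> - 1) - \<a>3 * \<z> \<noteq> 0" "\<y> * (\<x> * \<z> - 1) + \<a>2 * \<z> \<noteq> 0"
  "\<z> * \<x> - 1 \<noteq> 0" "\<w> * (\<z> * \<x> - 1) - \<a>3 * \<x> \<noteq> 0" "\<w> * (\<z> * \<x> - 1) + \<a>4 * \<x> \<noteq> 0"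
  "(\<z> - 1) * \<w> + \<a>4 \<noteq> 0" "(\<t> - \<x>) * \<y> - \<a>2 \<noteq> 0"
  by (rule has_value_nonzero[where P = generic_point],
      (rule has_value_intros has_value_generic has_value_generic_a0)+, simp)+

lemma neg_sum_eq: "p + q = r \<Longrightarrow> - p - q = - (r::ratfun)"
  by auto

lemmas braid_identities_0_2 =
  braid_identities[OF nonzero(1) nonzero_numerators(1,2,3), unfolded mult_1_right]
lemmas braid_identities_2_3 =
  braid_identities[OF nonzero(1) nonzero(8) nonzero_numerators(4,5)]
lemmas braid_identities_3_4 =
  braid_identities[OF nonzero(2) nonzero_numerators(6,7,8), unfolded mult.commute[of _ \<x>]
    add.commute[of \<a>4 \<a>3]]

section \<open>Commutation and braid relations between the reflections\<close>

lemma braid_0_1: "W0 \<circ> W1 = W1 \<circ> W0"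
  apply (rule ratfun_hom_eqI)
  apply (intro ratfun_hom_comp w0.ratfun_hom_axioms[folded W0_def]
    w1.ratfun_hom_axioms[folded W1_def])+
  apply (simp_all add: w0_simps w1_simps nonzero)
  done

lemma braid_0_2: "W0 \<circ> W2 \<circ> W0 = W2 \<circ> W0 \<circ> W2"
  apply (rule ratfun_hom_eqI)
  apply (intro ratfun_hom_comp w0.ratfun_hom_axioms[folded W0_def]
    w2.ratfun_hom_axioms[folded W2_def])+
  apply (simp_all add: w0_simps w2_simps nonzero)
  apply (simp_all only: add.commute[of \<a>2 \<a>0])
  \<comment> \<open>What is left are the equations for \<open>\<x>\<close> and \<open>\<y>\<close>,
    the coordinates that \<open>W2\<close> and \<open>W0\<close> move.\<close>
  subgoal by (rule braid_identities_0_2)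
  subgoal by (rule neg_sum_eq[OF braid_identities_0_2(2)])
  done

lemma braid_0_3: "W0 \<circ> W3 = W3 \<circ> W0"
  apply (rule ratfun_hom_eqI)
  apply (intro ratfun_hom_comp w0.ratfun_hom_axioms[folded W0_def]
    w3.ratfun_hom_axioms[folded W3_def])+
  apply (simp_all add: w0_simps w3_simps nonzero)
  done

lemma braid_0_4: "W0 \<circ> W4 = W4 \<circ> W0"
  apply (rule ratfun_hom_eqI)
  apply (intro ratfun_hom_comp w0.ratfun_hom_axioms[folded W0_def]
    w4.ratfun_hom_axioms[folded W4_def])+
  apply (simp_all add: w0_simps w4_simps nonzero)
  done

lemma braid_0_5: "W0 \<circ> W5 = W5 \<circ> W0"
  apply (rule ratfun_hom_eqI)
  apply (intro ratfun_hom_comp w0.ratfun_hom_axioms[folded W0_def]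
    w5.ratfun_hom_axioms[folded W5_def])+
  apply (simp_all add: w0_simps w5_simps nonzero)
  done

lemma braid_0_6: "W0 \<circ> W6 = W6 \<circ> W0"
  apply (rule ratfun_hom_eqI)
  apply (intro ratfun_hom_comp w0.ratfun_hom_axioms[folded W0_def]
    w6.ratfun_hom_axioms[folded W6_def])+
  apply (simp_all add: w0_simps w6_simps nonzero)
  by (metis minus_diff_eq minus_divide_right)

lemma braid_1_2: "W1 \<circ> W2 \<circ> W1 = W2 \<circ> W1 \<circ> W2"
  apply (rule ratfun_hom_eqI)
  apply (intro ratfun_hom_comp w1.ratfun_hom_axioms[folded W1_def]
    w2.ratfun_hom_axioms[folded W2_def])+
  apply (simp_all add: w1_simps w2_simps nonzero)
  by (simp add: add_divide_distrib)

lemma braid_1_3: "W1 \<circ> W3 = W3 \<circ> W1"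
  apply (rule ratfun_hom_eqI)
  apply (intro ratfun_hom_comp w1.ratfun_hom_axioms[folded W1_def]
    w3.ratfun_hom_axioms[folded W3_def])+
  apply (simp_all add: w1_simps w3_simps nonzero)
  done

lemma braid_1_4: "W1 \<circ> W4 = W4 \<circ> W1"
  apply (rule ratfun_hom_eqI)
  apply (intro ratfun_hom_comp w1.ratfun_hom_axioms[folded W1_def]
    w4.ratfun_hom_axioms[folded W4_def])+
  apply (simp_all add: w1_simps w4_simps nonzero)
  done

lemma braid_1_5: "W1 \<circ> W5 = W5 \<circ> W1"
  apply (rule ratfun_hom_eqI)
  apply (intro ratfun_hom_comp w1.ratfun_hom_axioms[folded W1_def]
    w5.ratfun_hom_axioms[folded W5_def])+
  apply (simp_all add: w1_simps w5_simps nonzero)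
  done

lemma braid_1_6: "W1 \<circ> W6 = W6 \<circ> W1"
  apply (rule ratfun_hom_eqI)
  apply (intro ratfun_hom_comp w1.ratfun_hom_axioms[folded W1_def]
    w6.ratfun_hom_axioms[folded W6_def])+
  apply (simp_all add: w1_simps w6_simps nonzero)
  done

lemma braid_2_3: "W2 \<circ> W3 \<circ> W2 = W3 \<circ> W2 \<circ> W3"
  apply (rule ratfun_hom_eqI)
  apply (intro ratfun_hom_comp w2.ratfun_hom_axioms[folded W2_def]
    w3.ratfun_hom_axioms[folded W3_def])+
  apply (simp_all add: w2_simps w3_simps nonzero)
  apply (simp_all only: add.commute[of \<a>2 \<a>3])
  subgoal by (rule braid_identities_2_3(1)[symmetric])
  subgoal by (rule neg_sum_eq[OF braid_identities_2_3(2), symmetric])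
  subgoal by (rule neg_sum_eq[OF braid_identities_2_3(3), symmetric])
  done

lemma braid_2_4: "W2 \<circ> W4 = W4 \<circ> W2"
  apply (rule ratfun_hom_eqI)
  apply (intro ratfun_hom_comp w2.ratfun_hom_axioms[folded W2_def]
    w4.ratfun_hom_axioms[folded W4_def])+
  apply (simp_all add: w2_simps w4_simps nonzero)
  done

lemma braid_2_5: "W2 \<circ> W5 = W5 \<circ> W2"
  apply (rule ratfun_hom_eqI)
  apply (intro ratfun_hom_comp w2.ratfun_hom_axioms[folded W2_def]
    w5.ratfun_hom_axioms[folded W5_def])+
  apply (simp_all add: w2_simps w5_simps nonzero)
  done

lemma braid_2_6: "W2 \<circ> W6 = W6 \<circ> W2"
  apply (rule ratfun_hom_eqI)
  apply (intro ratfun_hom_comp w2.ratfun_hom_axioms[folded W2_def]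
    w6.ratfun_hom_axioms[folded W6_def])+
  apply (simp_all add: w2_simps w6_simps nonzero)
  done

lemma braid_3_4: "W3 \<circ> W4 \<circ> W3 = W4 \<circ> W3 \<circ> W4"
  apply (rule ratfun_hom_eqI)
  apply (intro ratfun_hom_comp w3.ratfun_hom_axioms[folded W3_def]
    w4.ratfun_hom_axioms[folded W4_def])+
  apply (simp_all add: w3_simps w4_simps nonzero)
  apply (simp_all only: add.commute[of \<a>4 \<a>3] mult.commute[of _ \<x>])
  \<comment> \<open>Here \<open>\<z>\<close> and \<open>\<w>\<close> are the main pair and
    \<open>\<y>\<close> is the companion, so the third identity comes first.\<close>
  subgoal by (rule neg_sum_eq[OF braid_identities_3_4(3)])
  subgoal by (rule braid_identities_3_4)
  subgoal by (rule neg_sum_eq[OF braid_identities_3_4(2)])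
  done

lemma braid_3_5: "W3 \<circ> W5 = W5 \<circ> W3"
  apply (rule ratfun_hom_eqI)
  apply (intro ratfun_hom_comp w3.ratfun_hom_axioms[folded W3_def]
    w5.ratfun_hom_axioms[folded W5_def])+
  apply (simp_all add: w3_simps w5_simps nonzero)
  done

lemma braid_3_6: "W3 \<circ> W6 = W6 \<circ> W3"
  apply (rule ratfun_hom_eqI)
  apply (intro ratfun_hom_comp w3.ratfun_hom_axioms[folded W3_def]
    w6.ratfun_hom_axioms[folded W6_def])+
  apply (simp_all add: w3_simps w6_simps nonzero)
  by (simp_all add: w3_w6_denominator nonzero divide_simps) (simp_all add: nonzero algebra_simps)

lemma braid_4_5: "W4 \<circ> W5 \<circ> W4 = W5 \<circ> W4 \<circ> W5"
  apply (rule ratfun_hom_eqI)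
  apply (intro ratfun_hom_comp w4.ratfun_hom_axioms[folded W4_def]
    w5.ratfun_hom_axioms[folded W5_def])+
  apply (simp_all add: w4_simps w5_simps nonzero)
  by (simp add: add_divide_distrib)

lemma braid_4_6: "W4 \<circ> W6 = W6 \<circ> W4"
  apply (rule ratfun_hom_eqI)
  apply (intro ratfun_hom_comp w4.ratfun_hom_axioms[folded W4_def]
    w6.ratfun_hom_axioms[folded W6_def])+
  apply (simp_all add: w4_simps w6_simps nonzero)
  subgoal by (rule w4_w6_identity[OF nonzero(2,13) nonzero_numerators(9)])
  subgoal by (simp add: nonzero field_simps)
  done

text \<open>\<open>W5\<close> fixes all coordinates but shifts the \<open>\<a>4\<close> in the image
  of \<open>\<w>\<close> under \<open>W6\<close>. Both words send \<open>\<w>\<close> to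
  \<open>\<w> - (\<a>5 + 2 * \<a>6) / (\<z> - 1)\<close>, whose numerator \<open>W5\<close> leaves
  fixed.\<close>

lemma braid_5_6: "W5 \<circ> W6 \<circ> W5 \<circ> W6 = W6 \<circ> W5 \<circ> W6 \<circ> W5"
  apply (rule ratfun_hom_eqI)
  apply (intro ratfun_hom_comp w5.ratfun_hom_axioms[folded W5_def]
    w6.ratfun_hom_axioms[folded W6_def])+
  apply (simp_all add: w5_simps w6_simps nonzero)
  by (simp add: nonzero denominator_w6 field_simps)

section \<open>Conjugation of the reflections by \<open>\<Psi>\<close>\<close>

lemma psi_comp_w0: "\<Psi> \<circ> W0 = W1 \<circ> \<Psi>"
  apply (rule ratfun_hom_eqI)
  apply (intro ratfun_hom_comp psi.ratfun_hom_axioms[folded \<Psi>_def]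
    w0.ratfun_hom_axioms[folded W0_def] w1.ratfun_hom_axioms[folded W1_def])+
  apply (simp_all add: w0_simps w1_simps psi_simps nonzero)
  by (simp_all add: nonzero divide_simps) (simp_all add: nonzero algebra_simps)

lemma psi_comp_w1: "\<Psi> \<circ> W1 = W0 \<circ> \<Psi>"
  apply (rule ratfun_hom_eqI)
  apply (intro ratfun_hom_comp psi.ratfun_hom_axioms[folded \<Psi>_def]
    w1.ratfun_hom_axioms[folded W1_def] w0.ratfun_hom_axioms[folded W0_def])+
  apply (simp_all add: w1_simps w0_simps psi_simps nonzero)
  by (simp_all add: nonzero divide_simps) (simp_all add: nonzero algebra_simps)

lemma psi_comp_w2: "\<Psi> \<circ> W2 = W2 \<circ> \<Psi>"
  apply (rule ratfun_hom_eqI)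
  apply (intro ratfun_hom_comp psi.ratfun_hom_axioms[folded \<Psi>_def]
    w2.ratfun_hom_axioms[folded W2_def] w2.ratfun_hom_axioms[folded W2_def])+
  apply (simp_all add: w2_simps w2_simps psi_simps nonzero)
  subgoal by (rule psi_w2_identity[OF nonzero(15,1) nonzero_numerators(10)])
  subgoal by (simp add: nonzero field_simps)
  done

lemma psi_comp_w3: "\<Psi> \<circ> W3 = W3 \<circ> \<Psi>"
  apply (rule ratfun_hom_eqI)
  apply (intro ratfun_hom_comp psi.ratfun_hom_axioms[folded \<Psi>_def]
    w3.ratfun_hom_axioms[folded W3_def] w3.ratfun_hom_axioms[folded W3_def])+
  apply (simp_all add: w3_simps w3_simps psi_simps nonzero)
  by (simp_all add: psi_w3_denominator nonzero divide_simps) (simp_all add: nonzero algebra_simps)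

lemma psi_comp_w4: "\<Psi> \<circ> W4 = W4 \<circ> \<Psi>"
  apply (rule ratfun_hom_eqI)
  apply (intro ratfun_hom_comp psi.ratfun_hom_axioms[folded \<Psi>_def]
    w4.ratfun_hom_axioms[folded W4_def] w4.ratfun_hom_axioms[folded W4_def])+
  apply (simp_all add: w4_simps w4_simps psi_simps nonzero)
  by (simp_all add: nonzero divide_simps) (simp_all add: nonzero algebra_simps)

lemma psi_comp_w5: "\<Psi> \<circ> W5 = W5 \<circ> \<Psi>"
  apply (rule ratfun_hom_eqI)
  apply (intro ratfun_hom_comp psi.ratfun_hom_axioms[folded \<Psi>_def]
    w5.ratfun_hom_axioms[folded W5_def] w5.ratfun_hom_axioms[folded W5_def])+
  apply (simp_all add: w5_simps w5_simps psi_simps nonzero)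
  done

lemma psi_comp_w6: "\<Psi> \<circ> W6 = W6 \<circ> \<Psi>"
  apply (rule ratfun_hom_eqI)
  apply (intro ratfun_hom_comp psi.ratfun_hom_axioms[folded \<Psi>_def]
    w6.ratfun_hom_axioms[folded W6_def] w6.ratfun_hom_axioms[folded W6_def])+
  apply (simp_all add: w6_simps w6_simps psi_simps nonzero)
  by (simp_all add: psi_w6_denominator nonzero divide_simps) (simp_all add: nonzero algebra_simps)

text \<open>In the word \<open>(a \<circ> b) ^^ m\<close> of length \<open>2 * m\<close>, the braid
  relation replaces the outer \<open>m\<close> letters by the inverse of the inner ones, and the
  letters then cancel in pairs.\<close>

lemma comp_power_involutions:
  fixes a b :: "'a \<Rightarrow> 'a"
  assumes "a \<circ> a = id" "b \<circ> b = id"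
  shows "a \<circ> b = b \<circ> a \<Longrightarrow> (a \<circ> b) ^^ 2 = id"
    and "a \<circ> b \<circ> a = b \<circ> a \<circ> b \<Longrightarrow> (a \<circ> b) ^^ 3 = id"
    and "a \<circ> b \<circ> a \<circ> b = b \<circ> a \<circ> b \<circ> a \<Longrightarrow> (a \<circ> b) ^^ 4 = id"
proof -
  have aa: "a (a v) = v" and bb: "b (b v) = v" for v
    using assms by (simp_all add: fun_eq_iff)
  show "(a \<circ> b) ^^ 2 = id" if "a \<circ> b = b \<circ> a"
  proof
    fix v
    have "a (b u) = b (a u)" for u using that by (simp add: fun_eq_iff)
    from this[of "a (b v)"] this[of v] show "((a \<circ> b) ^^ 2) v = id v"
      by (simp add: numeral_2_eq_2 aa bb)
  qed
  show "(a \<circ> b) ^^ 3 = id" if "a \<circ> b \<circ> a = b \<circ> a \<circ> b"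
  proof
    fix v
    have "a (b (a u)) = b (a (b u))" for u using that by (simp add: fun_eq_iff)
    from this[of "b (a (b v))"] this[of v] show "((a \<circ> b) ^^ 3) v = id v"
      by (simp add: numeral_3_eq_3 aa bb)
  qed
  show "(a \<circ> b) ^^ 4 = id" if "a \<circ> b \<circ> a \<circ> b = b \<circ> a \<circ> b \<circ> a"
  proof
    fix v
    have "a (b (a (b u))) = b (a (b (a u)))" for u using that by (simp add: fun_eq_iff)
    from this[of "a (b (a (b v)))"] this[of v] show "((a \<circ> b) ^^ 4) v = id v"
      by (simp add: numeral_eq_Suc aa bb)
  qed
qed

lemmas W0_involution = w0.subst_comp_subst[folded W0_def]
lemmas W1_involution = w1.subst_comp_subst[folded W1_def]
lemmas W2_involution = w2.subst_comp_subst[folded W2_def]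
lemmas W3_involution = w3.subst_comp_subst[folded W3_def]
lemmas W4_involution = w4.subst_comp_subst[folded W4_def]
lemmas W5_involution = w5.subst_comp_subst[folded W5_def]
lemmas W6_involution = w6.subst_comp_subst[folded W6_def]
lemmas \<Psi>_involution = psi.subst_comp_subst[folded \<Psi>_def]

lemma coxeter_relations:
  "(W0 \<circ> W1) ^^ 2 = id" "(W0 \<circ> W2) ^^ 3 = id" "(W0 \<circ> W3) ^^ 2 = id" "(W0 \<circ> W4) ^^ 2 = id"
  "(W0 \<circ> W5) ^^ 2 = id" "(W0 \<circ> W6) ^^ 2 = id"
  "(W1 \<circ> W0) ^^ 2 = id" "(W1 \<circ> W2) ^^ 3 = id" "(W1 \<circ> W3) ^^ 2 = id" "(W1 \<circ> W4) ^^ 2 = id"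
  "(W1 \<circ> W5) ^^ 2 = id" "(W1 \<circ> W6) ^^ 2 = id"
  "(W2 \<circ> W0) ^^ 3 = id" "(W2 \<circ> W1) ^^ 3 = id" "(W2 \<circ> W3) ^^ 3 = id" "(W2 \<circ> W4) ^^ 2 = id"
  "(W2 \<circ> W5) ^^ 2 = id" "(W2 \<circ> W6) ^^ 2 = id"
  "(W3 \<circ> W0) ^^ 2 = id" "(W3 \<circ> W1) ^^ 2 = id" "(W3 \<circ> W2) ^^ 3 = id" "(W3 \<circ> W4) ^^ 3 = id"
  "(W3 \<circ> W5) ^^ 2 = id" "(W3 \<circ> W6) ^^ 2 = id"
  "(W4 \<circ> W0) ^^ 2 = id" "(W4 \<circ> W1) ^^ 2 = id" "(W4 \<circ> W2) ^^ 2 = id" "(W4 \<circ> W3) ^^ 3 = id"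
  "(W4 \<circ> W5) ^^ 3 = id" "(W4 \<circ> W6) ^^ 2 = id"
  "(W5 \<circ> W0) ^^ 2 = id" "(W5 \<circ> W1) ^^ 2 = id" "(W5 \<circ> W2) ^^ 2 = id" "(W5 \<circ> W3) ^^ 2 = id"
  "(W5 \<circ> W4) ^^ 3 = id" "(W5 \<circ> W6) ^^ 4 = id"
  "(W6 \<circ> W0) ^^ 2 = id" "(W6 \<circ> W1) ^^ 2 = id" "(W6 \<circ> W2) ^^ 2 = id" "(W6 \<circ> W3) ^^ 2 = id"
  "(W6 \<circ> W4) ^^ 2 = id" "(W6 \<circ> W5) ^^ 4 = id"
  using comp_power_involutions(1)[OF W0_involution W1_involution braid_0_1]
    comp_power_involutions(1)[OF W0_involution W3_involution braid_0_3]
    comp_power_involutions(1)[OF W0_involution W4_involution braid_0_4]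
    comp_power_involutions(1)[OF W0_involution W5_involution braid_0_5]
    comp_power_involutions(1)[OF W0_involution W6_involution braid_0_6]
    comp_power_involutions(1)[OF W1_involution W0_involution braid_0_1[symmetric]]
    comp_power_involutions(1)[OF W1_involution W3_involution braid_1_3]
    comp_power_involutions(1)[OF W1_involution W4_involution braid_1_4]
    comp_power_involutions(1)[OF W1_involution W5_involution braid_1_5]
    comp_power_involutions(1)[OF W1_involution W6_involution braid_1_6]
    comp_power_involutions(1)[OF W2_involution W4_involution braid_2_4]
    comp_power_involutions(1)[OF W2_involution W5_involution braid_2_5]
    comp_power_involutions(1)[OF W2_involution W6_involution braid_2_6]
    comp_power_involutions(1)[OF W3_involution W0_involution braid_0_3[symmetric]]
    comp_power_involutions(1)[OF W3_involution W1_involution braid_1_3[symmetric]]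
    comp_power_involutions(1)[OF W3_involution W5_involution braid_3_5]
    comp_power_involutions(1)[OF W3_involution W6_involution braid_3_6]
    comp_power_involutions(1)[OF W4_involution W0_involution braid_0_4[symmetric]]
    comp_power_involutions(1)[OF W4_involution W1_involution braid_1_4[symmetric]]
    comp_power_involutions(1)[OF W4_involution W2_involution braid_2_4[symmetric]]
    comp_power_involutions(1)[OF W4_involution W6_involution braid_4_6]
    comp_power_involutions(1)[OF W5_involution W0_involution braid_0_5[symmetric]]
    comp_power_involutions(1)[OF W5_involution W1_involution braid_1_5[symmetric]]
    comp_power_involutions(1)[OF W5_involution W2_involution braid_2_5[symmetric]]
    comp_power_involutions(1)[OF W5_involution W3_involution braid_3_5[symmetric]]
    comp_power_involutions(1)[OF W6_involution W0_involution braid_0_6[symmetric]]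
    comp_power_involutions(1)[OF W6_involution W1_involution braid_1_6[symmetric]]
    comp_power_involutions(1)[OF W6_involution W2_involution braid_2_6[symmetric]]
    comp_power_involutions(1)[OF W6_involution W3_involution braid_3_6[symmetric]]
    comp_power_involutions(1)[OF W6_involution W4_involution braid_4_6[symmetric]]
    comp_power_involutions(2)[OF W0_involution W2_involution braid_0_2]
    comp_power_involutions(2)[OF W1_involution W2_involution braid_1_2]
    comp_power_involutions(2)[OF W2_involution W0_involution braid_0_2[symmetric]]
    comp_power_involutions(2)[OF W2_involution W1_involution braid_1_2[symmetric]]
    comp_power_involutions(2)[OF W2_involution W3_involution braid_2_3]
    comp_power_involutions(2)[OF W3_involution W2_involution braid_2_3[symmetric]]
    comp_power_involutions(2)[OF W3_involution W4_involution braid_3_4]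
    comp_power_involutions(2)[OF W4_involution W3_involution braid_3_4[symmetric]]
    comp_power_involutions(2)[OF W4_involution W5_involution braid_4_5]
    comp_power_involutions(2)[OF W5_involution W4_involution braid_4_5[symmetric]]
    comp_power_involutions(3)[OF W5_involution W6_involution braid_5_6]
    comp_power_involutions(3)[OF W6_involution W5_involution braid_5_6[symmetric]]
  by (simp_all only:)

lemma conj_psi: "\<Psi> \<circ> f = g \<circ> \<Psi> \<Longrightarrow> \<Psi> \<circ> f \<circ> inv \<Psi> = g"
proof -
  have "inv \<Psi> = \<Psi>"
    using \<Psi>_involution by (metis inv_unique_comp)
  moreover assume "\<Psi> \<circ> f = g \<circ> \<Psi>"
  ultimately show ?thesis using \<Psi>_involution by (simp add: comp_assoc)
qed

section \<open>Values along a solution\<close>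

lemma has_value_point:
  "has_value \<x> (point \<alpha> x y z w t) x" "has_value \<y> (point \<alpha> x y z w t) y"
  "has_value \<z> (point \<alpha> x y z w t) z" "has_value \<w> (point \<alpha> x y z w t) w"
  "has_value \<t> (point \<alpha> x y z w t) t" "has_value \<a>1 (point \<alpha> x y z w t) (\<alpha> 1)"
  "has_value \<a>2 (point \<alpha> x y z w t) (\<alpha> 2)" "has_value \<a>3 (point \<alpha> x y z w t) (\<alpha> 3)"
  "has_value \<a>4 (point \<alpha> x y z w t) (\<alpha> 4)" "has_value \<a>5 (point \<alpha> x y z w t) (\<alpha> 5)"
  "has_value \<a>6 (point \<alpha> x y z w t) (\<alpha> 6)"
  unfolding \<x>_def \<y>_def \<z>_def \<w>_def \<t>_def \<a>1_def \<a>2_def \<a>3_def \<a>4_def \<a>5_def \<a>6_def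
  by (rule has_value_cong, rule has_value_indet, simp)+

text \<open>\<open>point\<close> does not read \<open>\<alpha> 0\<close>, so this formula holds for
  unnormalized parameters too. The shifted parameters in \<open>has_value_denominator\<close> rely
  on that, since shifting one of them breaks the normalization.\<close>

lemma has_value_a0:
  "has_value \<a>0 (point \<alpha> x y z w t)
     (1 - (\<alpha> 1 + 2 * \<alpha> 2 + 2 * \<alpha> 3 + 2 * \<alpha> 4 + 2 * \<alpha> 5 + 2 * \<alpha> 6))"
  unfolding a0_eq by (intro has_value_intros has_value_point)

lemma has_value_point_a0:
  "normalized \<alpha> \<Longrightarrow> has_value \<a>0 (point \<alpha> x y z w t) (\<alpha> 0)"
  by (rule has_value_cong, rule has_value_a0) (auto simp: normalized_def algebra_simps)

lemma continuous_poly_eval_line: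
  "continuous_on UNIV (\<lambda>s. poly_eval (point (\<lambda>i. \<alpha> i + s * \<beta> i) x y z w t) p)"
proof -
  have [continuous_intros]: "continuous_on UNIV (\<lambda>s. point (\<lambda>i. \<alpha> i + s * \<beta> i) x y z w t v)" for v
    by (cases v) (auto intro!: continuous_intros)
  show ?thesis unfolding poly_eval_def by (intro continuous_intros)
qed

text \<open>Where the denominator \<open>d\<close> vanishes the numerator may vanish as well, but moving the
  parameters along a line on which \<open>d\<close> stays zero makes the numerator nonzero. Since the
  value of \<open>f\<close> persists nearby, this is impossible.\<close>

lemma has_value_denominator:
  assumes "has_value f (point \<alpha> x y z w t) c" "f * d = n"
    and "\<And>s. has_value d (point (\<lambda>i. \<alpha> i + s * \<beta> i) x y z w t) 0"
    and "\<And>s. has_value n (point (\<lambda>i. \<alpha> i + s * \<beta> i) x y z w t) (u + s * v)"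
  shows "u = 0 \<and> v = 0"
proof -
  let ?P = "\<lambda>s. point (\<lambda>i. \<alpha> i + s * \<beta> i) x y z w t"
  obtain a b where f: "f = Fract a b" "poly_eval (?P 0) b \<noteq> 0"
    using assms(1) by (auto simp: has_value_def)
  \<comment> \<open>Wherever \<open>f\<close> is still regular, \<open>f * d\<close> has the value
    of \<open>f\<close> times zero, and this must be the value of \<open>n\<close>.\<close>
  have *: "u + s * v = 0" if "poly_eval (?P s) b \<noteq> 0" for s
  proof -
    have "has_value f (?P s) (poly_eval (?P s) a / poly_eval (?P s) b)"
      using that f(1) by (auto simp: has_value_def)
    from has_value_intros(2)[OF this assms(3)[of s]] show ?thesis
      using assms(4)[of s] unfolding assms(2) by (auto dest: has_value_unique)
  qed
  have u: "u = 0" using *[of 0] f(2) by simp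
  \<comment> \<open>Regularity is an open condition, so it also holds at some
    \<open>s \<noteq> 0\<close>. With \<open>u = 0\<close> the equation there reads
    \<open>s * v = 0\<close>.\<close>
  have "open {s. poly_eval (?P s) b \<noteq> 0}"
    by (intro open_Collect_neq continuous_poly_eval_line continuous_on_const)
  moreover have "0 \<in> {s. poly_eval (?P s) b \<noteq> 0}" using f(2) by simp
  ultimately obtain e where e: "e > 0" "ball 0 e \<subseteq> {s. poly_eval (?P s) b \<noteq> 0}"
    by (rule openE)
  define s where "s = complex_of_real (e / 2)"
  have "s \<in> ball 0 e" "s \<noteq> 0" using e(1) by (auto simp: s_def)
  then show ?thesis using *[of s] e(2) u by auto
qed

section \<open>The new parameters lie in the field generated by the old ones\<close>

lemma poly_indets_add: "poly_indets (p + q) \<subseteq> poly_indets p \<union> poly_indets q"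
  using keys_add[of p q] by (auto simp: poly_indets_def)

lemma poly_indets_mult: "poly_indets (p * q) \<subseteq> poly_indets p \<union> poly_indets q"
proof
  fix v assume "v \<in> poly_indets (p * q)"
  then obtain m n where "m \<in> Poly_Mapping.keys p" "n \<in> Poly_Mapping.keys q"
  "v \<in> Poly_Mapping.keys (m + n)"
    using keys_mult[of p q] by (auto simp: poly_indets_def)
  then show "v \<in> poly_indets p \<union> poly_indets q"
    using keys_add[of m n] by (auto simp: poly_indets_def)
qed

lemma poly_indets_uminus: "poly_indets (- p) = poly_indets p"
  by (auto simp: poly_indets_def in_keys_iff)

lemma poly_indets_0 [simp]: "poly_indets 0 = {}"
  by (simp add: poly_indets_def)

lemma poly_indets_1 [simp]: "poly_indets 1 = {}"
  by (simp add: poly_indets_def)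

lemma param_fieldI:
  assumes "f = Fract a b" "b \<noteq> 0" "poly_indets a \<subseteq> {Va1, Va2, Va3, Va4, Va5, Va6}"
    "poly_indets b \<subseteq> {Va1, Va2, Va3, Va4, Va5, Va6}"
  shows "f \<in> param_field"
  unfolding param_field_def mem_Collect_eq by (rule exI[of _ a], rule exI[of _ b], intro conjI assms)

lemma param_fieldE:
  assumes "f \<in> param_field"
  obtains a b where "f = Fract a b" "b \<noteq> 0" "poly_indets a \<subseteq> {Va1, Va2, Va3, Va4, Va5, Va6}"
    "poly_indets b \<subseteq> {Va1, Va2, Va3, Va4, Va5, Va6}"
  using assms unfolding param_field_def mem_Collect_eq by (elim exE conjE)

lemma param_field_add:
  assumes "f \<in> param_field" "g \<in> param_field"
  shows "f + g \<in> param_field"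
proof -
  obtain a b where f: "f = Fract a b" "b \<noteq> 0" "poly_indets a \<subseteq> {Va1, Va2, Va3, Va4, Va5, Va6}"
      "poly_indets b \<subseteq> {Va1, Va2, Va3, Va4, Va5, Va6}"
    using assms(1) by (rule param_fieldE)
  obtain c d where g: "g = Fract c d" "d \<noteq> 0" "poly_indets c \<subseteq> {Va1, Va2, Va3, Va4, Va5, Va6}"
      "poly_indets d \<subseteq> {Va1, Va2, Va3, Va4, Va5, Va6}"
    using assms(2) by (rule param_fieldE)
  show ?thesis
  proof (rule param_fieldI)
    show "f + g = Fract (a * d + c * b) (b * d)" "b * d \<noteq> 0" using f g by simp_all
  qed (intro order_trans[OF poly_indets_add] order_trans[OF poly_indets_mult] Un_least f g)+
qed

lemma param_field_uminus:
  assumes "f \<in> param_field"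
  shows "- f \<in> param_field"
  using assms
proof (rule param_fieldE)
  fix a b
  assume f: "f = Fract a b" "b \<noteq> 0" "poly_indets a \<subseteq> {Va1, Va2, Va3, Va4, Va5, Va6}"
      "poly_indets b \<subseteq> {Va1, Va2, Va3, Va4, Va5, Va6}"
  show ?thesis
    by (rule param_fieldI[of _ "- a" b]) (simp_all only: f poly_indets_uminus minus_fract not_False_eq_True)
qed

lemma param_field_diff:
  assumes "f \<in> param_field" "g \<in> param_field"
  shows "f - g \<in> param_field"
  unfolding diff_conv_add_uminus by (intro param_field_add param_field_uminus assms)

lemma param_field_1: "1 \<in> param_field"
  by (rule param_fieldI[OF One_fract_def]) simp_all

lemma param_field_double: "f \<in> param_field \<Longrightarrow> 2 * f \<in> param_field"
  unfolding mult_2 by (rule param_field_add)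

lemma param_field_indet:
  assumes "v \<in> {Va1, Va2, Va3, Va4, Va5, Va6}"
  shows "indet v \<in> param_field"
proof -
  let ?p = "Poly_Mapping.single (Poly_Mapping.single v 1) 1 :: mpoly"
  have "poly_indets ?p \<subseteq> {Va1, Va2, Va3, Va4, Va5, Va6}"
    using assms by (simp add: poly_indets_def)
  then show ?thesis
    by (intro param_fieldI[OF indet_def]) simp_all
qed

lemma param_field_params:
  "\<a>1 \<in> param_field" "\<a>2 \<in> param_field" "\<a>3 \<in> param_field" "\<a>4 \<in> param_field" "\<a>5 \<in> param_field"
  "\<a>6 \<in> param_field" "\<a>0 \<in> param_field"
  unfolding a0_eq \<a>1_def \<a>2_def \<a>3_def \<a>4_def \<a>5_def \<a>6_def
  by (intro param_field_diff param_field_1 param_field_add param_field_double param_field_indet; simp)+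

lemmas param_field_intros =
  param_field_add param_field_uminus param_field_diff param_field_double param_field_params

section \<open>The vector field\<close>

text \<open>The components of the Hamiltonian vector field are \<open>fx\<close>, \<open>fy\<close>, \<open>fz\<close>, \<open>fw\<close> divided by \<open>t (t - 1)\<close>.\<close>

definition fx where
  "fx \<alpha> x y z w t = 2 * y * (x - t) * (x - 1) * x
     - ((\<alpha> 0 - 1) * (x - 1) * x + (\<alpha> 3 + \<alpha> 5 + 2 * \<alpha> 6) * (x - t) * x
        + (\<alpha> 3 + 2 * \<alpha> 4 + \<alpha> 5) * (x - t) * (x - 1))
     + 2 * (x - t) * (z - 1) * w"
  for \<alpha> :: "nat \<Rightarrow> complex" and x y z w t :: complex

definition fy where
  "fy \<alpha> x y z w t = - (y\<^sup>2 * ((x - 1) * x + (x - t) * x + (x - t) * (x - 1)))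
     + ((\<alpha> 0 - 1) * (2 * x - 1) + (\<alpha> 3 + \<alpha> 5 + 2 * \<alpha> 6) * (2 * x - t)
        + (\<alpha> 3 + 2 * \<alpha> 4 + \<alpha> 5) * (2 * x - t - 1)) * y
     - \<alpha> 2 * (\<alpha> 1 + \<alpha> 2) - 2 * y * (z - 1) * w"
  for \<alpha> :: "nat \<Rightarrow> complex" and x y z w t :: complex

definition fz where
  "fz \<alpha> x y z w t = 2 * w * (t * z - 1) * (z - 1) * z
     - ((\<alpha> 0 + \<alpha> 3 - 1) * t * (z - 1) * z + (\<alpha> 1 + 2 * \<alpha> 2 + \<alpha> 3) * (z - 1) * (t * z - 1)
        + (\<alpha> 5 + 2 * \<alpha> 6) * z * (t * z - 1))
     + 2 * (x - t) * y * (z - 1)"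
  for \<alpha> :: "nat \<Rightarrow> complex" and x y z w t :: complex

definition fw where
  "fw \<alpha> x y z w t = - (w\<^sup>2 * (t * (z - 1) * z + (t * z - 1) * z + (t * z - 1) * (z - 1)))
     + ((\<alpha> 0 + \<alpha> 3 - 1) * t * (2 * z - 1) + (\<alpha> 1 + 2 * \<alpha> 2 + \<alpha> 3) * (2 * t * z - t - 1)
        + (\<alpha> 5 + 2 * \<alpha> 6) * (2 * t * z - 1)) * w
     - \<alpha> 4 * (\<alpha> 4 + \<alpha> 5) * t - 2 * (x - t) * y * w"
  for \<alpha> :: "nat \<Rightarrow> complex" and x y z w t :: complex

lemma partial_derivatives:
  "deriv (\<lambda>v. Ham \<alpha> x v z w t) y = fx \<alpha> x y z w t / (t * (t - 1))"
  "- deriv (\<lambda>v. Ham \<alpha> v y z w t) x = fy \<alpha> x y z w t / (t * (t - 1))"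
  "deriv (\<lambda>v. Ham \<alpha> x y z v t) w = fz \<alpha> x y z w t / (t * (t - 1))"
  "- deriv (\<lambda>v. Ham \<alpha> x y v w t) z = fw \<alpha> x y z w t / (t * (t - 1))"
proof -
  \<comment> \<open>With the prefactor opaque, each partial derivative becomes a polynomial identity
    in \<open>r\<close> and the other quantities, valid at every \<open>t\<close>.\<close>
  define r where "r = 1 / (t * (t - 1))"
  have r: "a / (t * (t - 1)) = r * a" for a by (simp add: r_def)
  note unf = Ham_def H_VI_def H_VI_tilde_def power2_eq_square r mult_1_right
  note simps =
    mult_zero_left mult_zero_right add_0_left add_0_right diff_0_right mult_1_right mult_1_left
  show "deriv (\<lambda>v. Ham \<alpha> x v z w t) y = fx \<alpha> x y z w t / (t * (t - 1))"
    unfolding fx_def unf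
    by (rule DERIV_imp_deriv, (rule derivative_eq_intros refl)+, simp only: simps) algebra
  have "deriv (\<lambda>v. Ham \<alpha> v y z w t) x = - (fy \<alpha> x y z w t / (t * (t - 1)))"
    unfolding fy_def unf
    by (rule DERIV_imp_deriv, (rule derivative_eq_intros refl)+, simp only: simps) algebra
  then show "- deriv (\<lambda>v. Ham \<alpha> v y z w t) x = fy \<alpha> x y z w t / (t * (t - 1))" by simp
  show "deriv (\<lambda>v. Ham \<alpha> x y z v t) w = fz \<alpha> x y z w t / (t * (t - 1))"
    unfolding fz_def unf
    by (rule DERIV_imp_deriv, (rule derivative_eq_intros refl)+, simp only: simps) algebra
  have "deriv (\<lambda>v. Ham \<alpha> x y v w t) z = - (fw \<alpha> x y z w t / (t * (t - 1)))"
    unfolding fw_def unf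
    by (rule DERIV_imp_deriv, (rule derivative_eq_intros refl)+, simp only: simps) algebra
  then show "- deriv (\<lambda>v. Ham \<alpha> x y v w t) z = fw \<alpha> x y z w t / (t * (t - 1))" by simp
qed

text \<open>Here \<open>k\<close> is the derivative of the new independent variable \<open>T\<close> with respect to \<open>t\<close>.\<close>

definition flow_at where
  "flow_at \<alpha> x y z w k X Y Z W T t \<longleftrightarrow>
     (X has_field_derivative k * (fx \<alpha> x y z w T / (T * (T - 1)))) (at t) \<and>
     (Y has_field_derivative k * (fy \<alpha> x y z w T / (T * (T - 1)))) (at t) \<and>
     (Z has_field_derivative k * (fz \<alpha> x y z w T / (T * (T - 1)))) (at t) \<and>
     (W has_field_derivative k * (fw \<alpha> x y z w T / (T * (T - 1)))) (at t)"

lemma solves_iff: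
  "solves \<alpha> U x y z w \<longleftrightarrow> (\<forall>t\<in>U. flow_at \<alpha> (x t) (y t) (z t) (w t) 1 x y z w t t)"
  by (simp add: solves_def flow_at_def partial_derivatives)

lemma derivative_affine:
  fixes X x' :: "complex \<Rightarrow> complex"
  assumes "open U" "s \<in> U" "k \<noteq> 0" "\<And>s. s \<in> U \<Longrightarrow> x' (k * s + d) = X s"
    and "(X has_field_derivative k * D) (at s)"
  shows "(x' has_field_derivative D) (at (k * s + d))"
proof -
  let ?i = "\<lambda>u. (u - d) / k"
  have i: "?i (k * s + d) = s" using assms(3) by simp
  have "(?i has_field_derivative 1 / k) (at (k * s + d))"
    using assms(3) by (auto intro!: derivative_eq_intros)
  moreover have "(X has_field_derivative k * D) (at (?i (k * s + d)))"
    using assms(5) by (simp only: i)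
  ultimately have "((\<lambda>u. X (?i u)) has_field_derivative k * D * (1 / k)) (at (k * s + d))"
    by (rule DERIV_chain2[rotated])
  then have D: "((\<lambda>u. X (?i u)) has_field_derivative D) (at (k * s + d))"
    using assms(3) by simp
  have "open (?i -` U)"
    by (rule open_vimage[OF assms(1)]) (auto intro!: continuous_intros assms(3))
  with D show ?thesis
  proof (rule has_field_derivative_transform_within_open)
    show "k * s + d \<in> ?i -` U" using i assms(2) by simp
    show "X (?i u) = x' u" if "u \<in> ?i -` U" for u
      using assms(4)[of "?i u"] that assms(3) by simp
  qed
qed

text \<open>The definition of \<open>baecklund\<close> prescribes the new parameter vector only up
  to index 6, so it need not equal \<open>A \<alpha>\<close> as a function.\<close>

lemma flow_at_cong:
  assumes "\<And>i. i \<le> 6 \<Longrightarrow> \<beta> i = \<alpha> i"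
  shows "flow_at \<beta> = flow_at \<alpha>"
  by (intro ext) (simp add: flow_at_def fx_def fy_def fz_def fw_def assms)

text \<open>Separates algebra from analysis. In \<open>val\<close>, uniqueness of values turns the
  relational description into explicit formulas \<open>X\<close>, \<open>Y\<close>,
  \<open>Z\<close>, \<open>W\<close> and yields the nonvanishing condition \<open>R\<close>; in
  \<open>der\<close>, these formulas are differentiated along a solution at a single time. The
  affine form \<open>k * t + d\<close> covers both time changes that occur, the identity and
  \<open>1 - t\<close>.\<close>

lemma baecklundI:
  fixes X Y Z W :: "(nat \<Rightarrow> complex) \<Rightarrow> complex \<Rightarrow> complex \<Rightarrow> complex \<Rightarrow> complex \<Rightarrow> complex \<Rightarrow> complex"
  assumes \<sigma>: "field_automorphism \<sigma>" "\<sigma> ` set params \<subseteq> param_field" and "k \<noteq> 0"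
    and val: "\<And>\<alpha> \<alpha>' x y z w t x' y' z' w' t' P. normalized \<alpha> \<Longrightarrow> t \<noteq> 0 \<Longrightarrow> t \<noteq> 1 \<Longrightarrow>
      P = point \<alpha> x y z w t \<Longrightarrow> has_value (\<sigma> \<x>) P x' \<Longrightarrow> has_value (\<sigma> \<y>) P y' \<Longrightarrow>
      has_value (\<sigma> \<z>) P z' \<Longrightarrow> has_value (\<sigma> \<w>) P w' \<Longrightarrow> has_value (\<sigma> \<t>) P t' \<Longrightarrow>
      \<forall>i\<le>6. has_value (\<sigma> (params ! i)) P (\<alpha>' i) \<Longrightarrow>
      R x y z w t \<and> x' = X \<alpha> x y z w t \<and> y' = Y \<alpha> x y z w t \<and> z' = Z \<alpha> x y z w t \<and>
      w' = W \<alpha> x y z w t \<and> t' = k * t + d \<and> (\<forall>i\<le>6. \<alpha>' i = A \<alpha> i)"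
    and der: "\<And>\<alpha> x y z w t. normalized \<alpha> \<Longrightarrow> t \<noteq> 0 \<Longrightarrow> t \<noteq> 1 \<Longrightarrow> R (x t) (y t) (z t) (w t) t \<Longrightarrow>
      flow_at \<alpha> (x t) (y t) (z t) (w t) 1 x y z w t t \<Longrightarrow>
      flow_at (A \<alpha>) (X \<alpha> (x t) (y t) (z t) (w t) t) (Y \<alpha> (x t) (y t) (z t) (w t) t)
        (Z \<alpha> (x t) (y t) (z t) (w t) t) (W \<alpha> (x t) (y t) (z t) (w t) t) k
        (\<lambda>s. X \<alpha> (x s) (y s) (z s) (w s) s) (\<lambda>s. Y \<alpha> (x s) (y s) (z s) (w s) s)
        (\<lambda>s. Z \<alpha> (x s) (y s) (z s) (w s) s) (\<lambda>s. W \<alpha> (x s) (y s) (z s) (w s) s) (k * t + d) t"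
  shows "baecklund \<sigma>"
  unfolding baecklund_def
proof (intro conjI \<sigma> allI impI, elim conjE)
  fix \<alpha> \<alpha>' U T x y z w x' y' z' w'
  assume n: "normalized \<alpha>" and U: "open U" "0 \<notin> U" "1 \<notin> U" and sol: "solves \<alpha> U x y z w"
    and all: "\<forall>s\<in>U. let P = point \<alpha> (x s) (y s) (z s) (w s) s in
           has_value (\<sigma> \<x>) P (x' (T s)) \<and>
           has_value (\<sigma> \<y>) P (y' (T s)) \<and>
           has_value (\<sigma> \<z>) P (z' (T s)) \<and>
           has_value (\<sigma> \<w>) P (w' (T s)) \<and>
           has_value (\<sigma> \<t>) P (T s) \<and>
           (\<forall>i\<le>6. has_value (\<sigma> (params ! i)) P (\<alpha>' i))"
  let ?F = "\<lambda>F s. F \<alpha> (x s) (y s) (z s) (w s) s"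
  have vals: "R (x s) (y s) (z s) (w s) s \<and> x' (T s) = ?F X s \<and> y' (T s) = ?F Y s \<and>
      z' (T s) = ?F Z s \<and> w' (T s) = ?F W s \<and> T s = k * s + d \<and> (\<forall>i\<le>6. \<alpha>' i = A \<alpha> i)"
    if "s \<in> U" for s
    by (rule val[OF n _ _ refl]) (use all that U in \<open>auto simp: Let_def\<close>)
  show "solves \<alpha>' (T ` U) x' y' z' w'"
    unfolding solves_iff
  proof
    fix u assume "u \<in> T ` U"
    then obtain s where s: "s \<in> U" "u = T s" by auto
    have T: "T s = k * s + d" if "s \<in> U" for s using vals[OF that] by simp
    have flow: "flow_at \<alpha>' (?F X s) (?F Y s) (?F Z s) (?F W s) k (?F X) (?F Y) (?F Z) (?F W) (k * s + d) s"
      using der[OF n, of s x y z w] sol s U vals[OF s(1)] flow_at_cong[of \<alpha>' "A \<alpha>"]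
      by (auto simp: solves_iff)
    have X: "x' (k * s + d) = ?F X s" and Y: "y' (k * s + d) = ?F Y s"
      and Z: "z' (k * s + d) = ?F Z s" and W: "w' (k * s + d) = ?F W s" if "s \<in> U" for s
      using vals[OF that] by metis+
    note D = derivative_affine[OF U(1) s(1) \<open>k \<noteq> 0\<close>, where d = d]
    show "flow_at \<alpha>' (x' u) (y' u) (z' u) (w' u) 1 x' y' z' w' u u"
      unfolding s(2) T[OF s(1)] X[OF s(1)] Y[OF s(1)] Z[OF s(1)] W[OF s(1)] flow_at_def mult_1
      by (intro conjI D[where x' = x' and X = "?F X", OF X] D[where x' = y' and X = "?F Y", OF Y]
        D[where x' = z' and X = "?F Z", OF Z] D[where x' = w' and X = "?F W", OF W])
        (use flow in \<open>simp_all add: flow_at_def\<close>)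
  qed
qed

text \<open>The normalization is used to eliminate one parameter. \<open>w0_flow\<close> must retain
  \<open>\<alpha> 0\<close>, which it replaces by \<open>u * (x - t)\<close>, and therefore
  eliminates \<open>\<alpha> 1\<close>.\<close>

lemma normalized_0: "normalized \<alpha> \<Longrightarrow> \<alpha> 0 = 1 - \<alpha> 1 - 2 * \<alpha> 2 - 2 * \<alpha> 3 - 2 * \<alpha> 4 - 2 * \<alpha> 5 - 2 * \<alpha> 6"
  and normalized_1: "normalized \<alpha> \<Longrightarrow> \<alpha> 1 = 1 - \<alpha> 0 - 2 * \<alpha> 2 - 2 * \<alpha> 3 - 2 * \<alpha> 4 - 2 * \<alpha> 5 - 2 * \<alpha> 6"
  unfolding normalized_def by algebra+

section \<open>Transformation of the vector field as polynomial identities\<close>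

lemmas f_defs = fx_def fy_def fz_def fw_def

text \<open>The action on numerical parameters. Values beyond index 6 are unspecified, which
  \<open>flow_at_cong\<close> makes harmless.\<close>

definition "A0 \<alpha> = (!) [- \<alpha> 0, \<alpha> 1, \<alpha> 2 + \<alpha> 0, \<alpha> 3, \<alpha> 4, \<alpha> 5, \<alpha> 6 :: complex]"
definition "A1 \<alpha> = (!) [\<alpha> 0, - \<alpha> 1, \<alpha> 2 + \<alpha> 1, \<alpha> 3, \<alpha> 4, \<alpha> 5, \<alpha> 6 :: complex]"
definition "A2 \<alpha> = (!) [\<alpha> 0 + \<alpha> 2, \<alpha> 1 + \<alpha> 2, - \<alpha> 2, \<alpha> 3 + \<alpha> 2, \<alpha> 4, \<alpha> 5, \<alpha> 6 :: complex]"
definition "A3 \<alpha> = (!) [\<alpha> 0, \<alpha> 1, \<alpha> 2 + \<alpha> 3, - \<alpha> 3, \<alpha> 4 + \<alpha> 3, \<alpha> 5, \<alpha> 6 :: complex]"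
definition "A4 \<alpha> = (!) [\<alpha> 0, \<alpha> 1, \<alpha> 2, \<alpha> 3 + \<alpha> 4, - \<alpha> 4, \<alpha> 5 + \<alpha> 4, \<alpha> 6 :: complex]"
definition "A5 \<alpha> = (!) [\<alpha> 0, \<alpha> 1, \<alpha> 2, \<alpha> 3, \<alpha> 4 + \<alpha> 5, - \<alpha> 5, \<alpha> 6 + \<alpha> 5 :: complex]"
definition "A6 \<alpha> = (!) [\<alpha> 0, \<alpha> 1, \<alpha> 2, \<alpha> 3, \<alpha> 4, \<alpha> 5 + 2 * \<alpha> 6, - \<alpha> 6 :: complex]"
definition "A_psi \<alpha> = (!) [\<alpha> 1, \<alpha> 0, \<alpha> 2, \<alpha> 3, \<alpha> 4, \<alpha> 5, \<alpha> 6 :: complex]"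

lemma A0_nth:
  "A0 \<alpha> 0 = - \<alpha> 0" "A0 \<alpha> 1 = \<alpha> 1" "A0 \<alpha> 2 = \<alpha> 2 + \<alpha> 0" "A0 \<alpha> 3 = \<alpha> 3" "A0 \<alpha> 4 = \<alpha> 4" "A0 \<alpha> 5 = \<alpha> 5"
  "A0 \<alpha> 6 = \<alpha> 6"
  by (simp_all add: A0_def)

lemma A1_nth:
  "A1 \<alpha> 0 = \<alpha> 0" "A1 \<alpha> 1 = - \<alpha> 1" "A1 \<alpha> 2 = \<alpha> 2 + \<alpha> 1" "A1 \<alpha> 3 = \<alpha> 3" "A1 \<alpha> 4 = \<alpha> 4" "A1 \<alpha> 5 = \<alpha> 5"
  "A1 \<alpha> 6 = \<alpha> 6"
  by (simp_all add: A1_def)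

lemma A2_nth:
  "A2 \<alpha> 0 = \<alpha> 0 + \<alpha> 2" "A2 \<alpha> 1 = \<alpha> 1 + \<alpha> 2" "A2 \<alpha> 2 = - \<alpha> 2" "A2 \<alpha> 3 = \<alpha> 3 + \<alpha> 2" "A2 \<alpha> 4 = \<alpha> 4"
  "A2 \<alpha> 5 = \<alpha> 5" "A2 \<alpha> 6 = \<alpha> 6"
  by (simp_all add: A2_def)

lemma A3_nth:
  "A3 \<alpha> 0 = \<alpha> 0" "A3 \<alpha> 1 = \<alpha> 1" "A3 \<alpha> 2 = \<alpha> 2 + \<alpha> 3" "A3 \<alpha> 3 = - \<alpha> 3" "A3 \<alpha> 4 = \<alpha> 4 + \<alpha> 3" "A3 \<alpha> 5 =
    \<alpha> 5" "A3 \<alpha> 6 = \<alpha> 6"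
  by (simp_all add: A3_def)

lemma A4_nth:
  "A4 \<alpha> 0 = \<alpha> 0" "A4 \<alpha> 1 = \<alpha> 1" "A4 \<alpha> 2 = \<alpha> 2" "A4 \<alpha> 3 = \<alpha> 3 + \<alpha> 4" "A4 \<alpha> 4 = - \<alpha> 4" "A4 \<alpha> 5 =
    \<alpha> 5 + \<alpha> 4" "A4 \<alpha> 6 = \<alpha> 6"
  by (simp_all add: A4_def)

lemma A5_nth:
  "A5 \<alpha> 0 = \<alpha> 0" "A5 \<alpha> 1 = \<alpha> 1" "A5 \<alpha> 2 = \<alpha> 2" "A5 \<alpha> 3 = \<alpha> 3" "A5 \<alpha> 4 = \<alpha> 4 + \<alpha> 5" "A5 \<alpha> 5 = - \<alpha> 5"
  "A5 \<alpha> 6 = \<alpha> 6 + \<alpha> 5"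
  by (simp_all add: A5_def)

lemma A6_nth:
  "A6 \<alpha> 0 = \<alpha> 0" "A6 \<alpha> 1 = \<alpha> 1" "A6 \<alpha> 2 = \<alpha> 2" "A6 \<alpha> 3 = \<alpha> 3" "A6 \<alpha> 4 = \<alpha> 4" "A6 \<alpha> 5 =
    \<alpha> 5 + 2 * \<alpha> 6" "A6 \<alpha> 6 = - \<alpha> 6"
  by (simp_all add: A6_def)

lemma A_psi_nth:
  "A_psi \<alpha> 0 = \<alpha> 1" "A_psi \<alpha> 1 = \<alpha> 0" "A_psi \<alpha> 2 = \<alpha> 2" "A_psi \<alpha> 3 = \<alpha> 3" "A_psi \<alpha> 4 = \<alpha> 4"
  "A_psi \<alpha> 5 = \<alpha> 5" "A_psi \<alpha> 6 = \<alpha> 6"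
  by (simp_all add: A_psi_def)

text \<open>After clearing \<open>t * (t - 1)\<close>, the quotient rule for
  \<open>\<alpha> 0 / (x - t)\<close> produces \<open>fx - t * (t - 1)\<close>: the pole
  \<open>x = t\<close> moves along with the independent variable.\<close>

lemma w0_flow:
  assumes "normalized \<alpha>" "\<alpha> 0 = u * (x - t)"
  shows "fx (A0 \<alpha>) x (y - u) z w t = fx \<alpha> x y z w t"
    "(x - t) * fy (A0 \<alpha>) x (y - u) z w t =
      (x - t) * fy \<alpha> x y z w t + u * (fx \<alpha> x y z w t - t * (t - 1))"
    "fz (A0 \<alpha>) x (y - u) z w t = fz \<alpha> x y z w t"
    "fw (A0 \<alpha>) x (y - u) z w t = fw \<alpha> x y z w t"
  unfolding f_defs A0_nth normalized_1[OF assms(1)] assms(2) by algebra+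

text \<open>The parameters 1 and 2 enter only through
  \<open>\<alpha> 2 * (\<alpha> 1 + \<alpha> 2)\<close> and
  \<open>\<alpha> 1 + 2 * \<alpha> 2\<close>, both invariant under the reflection.\<close>

lemma w1_flow:
  "fx (A1 \<alpha>) x y z w t = fx \<alpha> x y z w t" "fy (A1 \<alpha>) x y z w t = fy \<alpha> x y z w t"
  "fz (A1 \<alpha>) x y z w t = fz \<alpha> x y z w t" "fw (A1 \<alpha>) x y z w t = fw \<alpha> x y z w t"
  unfolding f_defs A1_nth by algebra+

lemma w2_flow:
  assumes "normalized \<alpha>" "\<alpha> 2 = u * y"
  shows "y * fx (A2 \<alpha>) (x + u) y z w t = y * fx \<alpha> x y z w t - u * fy \<alpha> x y z w t"
    "fy (A2 \<alpha>) (x + u) y z w t = fy \<alpha> x y z w t"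
    "fz (A2 \<alpha>) (x + u) y z w t = fz \<alpha> x y z w t"
    "fw (A2 \<alpha>) (x + u) y z w t = fw \<alpha> x y z w t"
  unfolding f_defs A2_nth normalized_0[OF assms(1)] assms(2) by algebra+

text \<open>With \<open>e = x * z - 1\<close>, the derivative of \<open>z / e\<close> is
  \<open>- (z' + z\<^sup>2 * x') / e\<^sup>2\<close>, and symmetrically for \<open>x / e\<close>.
  This gives the correction terms in the second and fourth identities.\<close>

lemma w3_flow:
  assumes "normalized \<alpha>" "\<alpha> 3 = u * (x * z - 1)"
  shows "fx (A3 \<alpha>) x (y - u * z) z (w - u * x) t = fx \<alpha> x y z w t"
    "(x * z - 1) * fy (A3 \<alpha>) x (y - u * z) z (w - u * x) t =
       (x * z - 1) * fy \<alpha> x y z w t + u * (fz \<alpha> x y z w t + z\<^sup>2 * fx \<alpha> x y z w t)"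
    "fz (A3 \<alpha>) x (y - u * z) z (w - u * x) t = fz \<alpha> x y z w t"
    "(x * z - 1) * fw (A3 \<alpha>) x (y - u * z) z (w - u * x) t =
       (x * z - 1) * fw \<alpha> x y z w t + u * (fx \<alpha> x y z w t + x\<^sup>2 * fz \<alpha> x y z w t)"
  unfolding f_defs A3_nth normalized_0[OF assms(1)] assms(2) by algebra+

lemma w4_flow:
  assumes "normalized \<alpha>" "\<alpha> 4 = u * w"
  shows "fx (A4 \<alpha>) x y (z + u) w t = fx \<alpha> x y z w t"
    "fy (A4 \<alpha>) x y (z + u) w t = fy \<alpha> x y z w t"
    "w * fz (A4 \<alpha>) x y (z + u) w t = w * fz \<alpha> x y z w t - u * fw \<alpha> x y z w t"
    "fw (A4 \<alpha>) x y (z + u) w t = fw \<alpha> x y z w t"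
  unfolding f_defs A4_nth normalized_0[OF assms(1)] assms(2) by algebra+

text \<open>The parameters 4, 5, 6 enter only through
  \<open>\<alpha> 3 + \<alpha> 5 + 2 * \<alpha> 6\<close>,
  \<open>\<alpha> 3 + 2 * \<alpha> 4 + \<alpha> 5\<close>,
  \<open>\<alpha> 5 + 2 * \<alpha> 6\<close> and
  \<open>\<alpha> 4 * (\<alpha> 4 + \<alpha> 5)\<close>, all preserved by the reflection.\<close>

lemma w5_flow:
  "fx (A5 \<alpha>) x y z w t = fx \<alpha> x y z w t" "fy (A5 \<alpha>) x y z w t = fy \<alpha> x y z w t"
  "fz (A5 \<alpha>) x y z w t = fz \<alpha> x y z w t" "fw (A5 \<alpha>) x y z w t = fw \<alpha> x y z w t"
  unfolding f_defs A5_nth by algebra+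

text \<open>The inverse \<open>q\<close> of \<open>z - 1\<close> is a separate unknown subject to
  \<open>q * v = 1\<close>, so \<open>z / (z - 1)\<close> becomes the polynomial
  \<open>q + 1\<close>. Time reversal cancels the minus sign in the derivative of each new
  coordinate.\<close>

lemma w6_flow:
  assumes "normalized \<alpha>" "v = z - 1" "q * v = 1"
    and "W = - (v * (v * w + \<alpha> 4))"
  shows "fx (A6 \<alpha>) (1 - x) (- y) (q + 1) W (1 - t) = fx \<alpha> x y z w t"
    "fy (A6 \<alpha>) (1 - x) (- y) (q + 1) W (1 - t) = fy \<alpha> x y z w t"
    "fz (A6 \<alpha>) (1 - x) (- y) (q + 1) W (1 - t) = q\<^sup>2 * fz \<alpha> x y z w t"
    "fw (A6 \<alpha>) (1 - x) (- y) (q + 1) W (1 - t) =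
       v\<^sup>2 * fw \<alpha> x y z w t + (2 * v * w + \<alpha> 4) * fz \<alpha> x y z w t"
  using assms(2,3) unfolding f_defs A6_nth normalized_0[OF assms(1)] assms(4) by algebra+

text \<open>\<open>p\<close>, \<open>r\<close>, \<open>s\<close> are unknowns for the inverses of
  \<open>t - x\<close>, \<open>t\<close>, \<open>t - 1\<close>. The terms
  \<open>t * (t - 1)\<close>, \<open>Y * (2 * t - 1)\<close>, \<open>1 - z\<close> and
  \<open>w\<close> on the right come from the explicit dependence of the transformation on
  \<open>t\<close>.\<close>

lemma psi_flow:
  assumes "normalized \<alpha>" "p * (t - x) = 1" "r * t = 1" "s * (t - 1) = 1"
    and "X = (t - 1) * x * p" "Y = (t - x) * ((t - x) * y - \<alpha> 2) * r * s" "Z = (t * z - 1) * s" "W =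
      (t - 1) * w * r"
  shows "fx (A_psi \<alpha>) X Y Z W (1 - t) =
      p\<^sup>2 * ((t - 1) * x * (t * (t - 1) - fx \<alpha> x y z w t) - (x * t * (t - 1) + (t - 1) * fx \<alpha> x y z w t) * (t - x))"
    "fy (A_psi \<alpha>) X Y Z W (1 - t) = Y * (2 * t - 1) - r * s *
       ((t * (t - 1) - fx \<alpha> x y z w t) * (2 * (t - x) * y - \<alpha> 2) + (t - x)\<^sup>2 * fy \<alpha> x y z w t)"
    "fz (A_psi \<alpha>) X Y Z W (1 - t) = - t * s * (fz \<alpha> x y z w t + 1 - z)"
    "fw (A_psi \<alpha>) X Y Z W (1 - t) = - (t - 1) * r * (fw \<alpha> x y z w t + w)"
  using assms(2-4) unfolding f_defs A_psi_nth normalized_0[OF assms(1)] assms(5-8) by algebra+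

lemma all_le_6: "(\<forall>i\<le>6. P i) \<longleftrightarrow> P 0 \<and> P 1 \<and> P 2 \<and> P 3 \<and> P 4 \<and> P 5 \<and> P (6::nat)"
proof -
  have "i \<le> 6 \<longleftrightarrow> i \<in> {0, 1, 2, 3, 4, 5, 6}" for i :: nat
    unfolding insert_iff empty_iff by arith
  then have "(\<forall>i\<le>6. P i) \<longleftrightarrow> (\<forall>i\<in>{0, 1, 2, 3, 4, 5, 6}. P i)" by blast
  then show ?thesis by simp
qed

lemma params_nth:
  "params ! 0 = \<a>0" "params ! 1 = \<a>1" "params ! 2 = \<a>2" "params ! 3 = \<a>3"
  "params ! 4 = \<a>4" "params ! 5 = \<a>5" "params ! 6 = \<a>6"
  by (simp_all add: params_def)

section \<open>The Baecklund property\<close>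

text \<open>The conclusion, including \<open>1 * t + 0\<close>, has the exact shape of
  \<open>val\<close> in \<open>baecklundI\<close>, so that it resolves without rewriting. The same
  holds for the other generators.\<close>

lemma w0_val:
  assumes n: "normalized \<alpha>" and t: "t \<noteq> 0" "t \<noteq> 1" and P: "P = point \<alpha> x y z w t"
    and vx: "has_value (W0 \<x>) P x'" and vy: "has_value (W0 \<y>) P y'"
    and vz: "has_value (W0 \<z>) P z'" and vw: "has_value (W0 \<w>) P w'"
    and vt: "has_value (W0 \<t>) P t'"
    and va: "\<forall>i\<le>6. has_value (W0 (params ! i)) P (\<alpha>' i)"
  shows "x \<noteq> t \<and> x' = x \<and> y' = y - \<alpha> 0 / (x - t) \<and> z' = z \<and>
    w' = w \<and> t' = 1 * t + 0 \<and> (\<forall>i\<le>6. \<alpha>' i = A0 \<alpha> i)"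
proof -
  note vals = has_value_intros has_value_point has_value_point_a0[OF n]
  have R: "x \<noteq> t"
  proof
    assume "x = t"
    \<comment> \<open>Raising \<open>\<alpha> 1\<close> by \<open>s\<close> lowers the value of
      \<open>\<a>0\<close> by \<open>s\<close>, so on \<open>x = t\<close> the numerator
      \<open>\<y> * (\<x> - \<t>) - \<a>0\<close> grows with slope 1, and slope zero is
      absurd.\<close>
    have "- (1 - (\<alpha> 1 + 2 * \<alpha> 2 + 2 * \<alpha> 3 + 2 * \<alpha> 4 + 2 * \<alpha> 5 + 2 * \<alpha> 6)) = (0::complex) \<and> 1 =
      (0::complex)"
    proof (rule has_value_denominator[OF vy[unfolded P w0_images(2)]])
      show "has_value (\<x> - \<t>) (point (\<lambda>i. \<alpha> i + s * (if i = 1 then 1 else 0)) x y z w t) 0" for s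
        by (rule has_value_cong, (rule has_value_intros has_value_point has_value_a0)+) (use \<open>x =
          t\<close> in simp)
      show "has_value (\<y> * (\<x> - \<t>) - \<a>0)
        (point (\<lambda>i. \<alpha> i + s * (if i = 1 then 1 else 0)) x y z w t) (- (1 - (\<alpha> 1 + 2 * \<alpha> 2 + 2 * \<alpha> 3 + 2 * \<alpha> 4 + 2 * \<alpha> 5 + 2 * \<alpha> 6)) + s * 1)" for s
        by (rule has_value_cong, (rule has_value_intros has_value_point has_value_a0)+)
          (use \<open>x = t\<close> in \<open>simp add: algebra_simps\<close>)
    qed (simp add: nonzero left_diff_distrib distrib_right)
    then show False using \<open>x = t\<close> t by simp
  qed
  have "x' = x"
    by (rule has_value_unique[OF vx[unfolded P w0_images(1)]]) ((rule vals) |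
      (use R t in \<open>simp; fail\<close>))+
  moreover
  have "y' = y - \<alpha> 0 / (x - t)"
    by (rule has_value_unique[OF vy[unfolded P w0_images(2)]]) ((rule vals) |
      (use R t in \<open>simp; fail\<close>))+
  moreover
  have "z' = z"
    by (rule has_value_unique[OF vz[unfolded P w0_images(3)]]) ((rule vals) |
      (use R t in \<open>simp; fail\<close>))+
  moreover
  have "w' = w"
    by (rule has_value_unique[OF vw[unfolded P w0_images(4)]]) ((rule vals) |
      (use R t in \<open>simp; fail\<close>))+
  moreover
  have "t' = t"
    by (rule has_value_unique[OF vt[unfolded P w0_images(5)]]) (rule vals)+
  moreover have "\<forall>i\<le>6. \<alpha>' i = A0 \<alpha> i"
    using va unfolding all_le_6 params_nth P w0_images(6-12) A0_nth
    by (intro conjI; elim conjE) (erule has_value_unique, (rule vals)+)+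
  ultimately show ?thesis using R by simp
qed

lemma w1_val:
  assumes n: "normalized \<alpha>" and t: "t \<noteq> 0" "t \<noteq> 1" and P: "P = point \<alpha> x y z w t"
    and vx: "has_value (W1 \<x>) P x'" and vy: "has_value (W1 \<y>) P y'"
    and vz: "has_value (W1 \<z>) P z'" and vw: "has_value (W1 \<w>) P w'"
    and vt: "has_value (W1 \<t>) P t'"
    and va: "\<forall>i\<le>6. has_value (W1 (params ! i)) P (\<alpha>' i)"
  shows "True \<and> x' = x \<and> y' = y \<and> z' = z \<and>
    w' = w \<and> t' = 1 * t + 0 \<and> (\<forall>i\<le>6. \<alpha>' i = A1 \<alpha> i)"
proof -
  note vals = has_value_intros has_value_point has_value_point_a0[OF n]
  have "x' = x"
    by (rule has_value_unique[OF vx[unfolded P w1_images(1)]]) ((rule vals) |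
      (use t t in \<open>simp; fail\<close>))+
  moreover
  have "y' = y"
    by (rule has_value_unique[OF vy[unfolded P w1_images(2)]]) ((rule vals) |
      (use t t in \<open>simp; fail\<close>))+
  moreover
  have "z' = z"
    by (rule has_value_unique[OF vz[unfolded P w1_images(3)]]) ((rule vals) |
      (use t t in \<open>simp; fail\<close>))+
  moreover
  have "w' = w"
    by (rule has_value_unique[OF vw[unfolded P w1_images(4)]]) ((rule vals) |
      (use t t in \<open>simp; fail\<close>))+
  moreover
  have "t' = t"
    by (rule has_value_unique[OF vt[unfolded P w1_images(5)]]) (rule vals)+
  moreover have "\<forall>i\<le>6. \<alpha>' i = A1 \<alpha> i"
    using va unfolding all_le_6 params_nth P w1_images(6-12) A1_nth
    by (intro conjI; elim conjE) (erule has_value_unique, (rule vals)+)+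
  ultimately show ?thesis by simp
qed

lemma w2_val:
  assumes n: "normalized \<alpha>" and t: "t \<noteq> 0" "t \<noteq> 1" and P: "P = point \<alpha> x y z w t"
    and vx: "has_value (W2 \<x>) P x'" and vy: "has_value (W2 \<y>) P y'"
    and vz: "has_value (W2 \<z>) P z'" and vw: "has_value (W2 \<w>) P w'"
    and vt: "has_value (W2 \<t>) P t'"
    and va: "\<forall>i\<le>6. has_value (W2 (params ! i)) P (\<alpha>' i)"
  shows "y \<noteq> 0 \<and> x' = x + \<alpha> 2 / y \<and> y' = y \<and> z' = z \<and>
    w' = w \<and> t' = 1 * t + 0 \<and> (\<forall>i\<le>6. \<alpha>' i = A2 \<alpha> i)"
proof -
  note vals = has_value_intros has_value_point has_value_point_a0[OF n]
  have R: "y \<noteq> 0"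
  proof
    assume "y = 0"
    have "\<alpha> 2 = (0::complex) \<and> 1 = (0::complex)"
    proof (rule has_value_denominator[OF vx[unfolded P w2_images(1)]])
      show "has_value \<y> (point (\<lambda>i. \<alpha> i + s * (if i = 2 then 1 else 0)) x y z w t) 0" for s
        by (rule has_value_cong, (rule has_value_intros has_value_point has_value_a0)+) (use \<open>y =
          0\<close> in simp)
      show "has_value (\<x> * \<y> + \<a>2)
        (point (\<lambda>i. \<alpha> i + s * (if i = 2 then 1 else 0)) x y z w t) (\<alpha> 2 + s * 1)" for s
        by (rule has_value_cong, (rule has_value_intros has_value_point has_value_a0)+)
          (use \<open>y = 0\<close> in \<open>simp add: algebra_simps\<close>)
    qed (simp add: nonzero left_diff_distrib distrib_right)
    then show False using \<open>y = 0\<close> t by simp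
  qed
  have "x' = x + \<alpha> 2 / y"
    by (rule has_value_unique[OF vx[unfolded P w2_images(1)]]) ((rule vals) |
      (use R t in \<open>simp; fail\<close>))+
  moreover
  have "y' = y"
    by (rule has_value_unique[OF vy[unfolded P w2_images(2)]]) ((rule vals) |
      (use R t in \<open>simp; fail\<close>))+
  moreover
  have "z' = z"
    by (rule has_value_unique[OF vz[unfolded P w2_images(3)]]) ((rule vals) |
      (use R t in \<open>simp; fail\<close>))+
  moreover
  have "w' = w"
    by (rule has_value_unique[OF vw[unfolded P w2_images(4)]]) ((rule vals) |
      (use R t in \<open>simp; fail\<close>))+
  moreover
  have "t' = t"
    by (rule has_value_unique[OF vt[unfolded P w2_images(5)]]) (rule vals)+
  moreover have "\<forall>i\<le>6. \<alpha>' i = A2 \<alpha> i"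
    using va unfolding all_le_6 params_nth P w2_images(6-12) A2_nth
    by (intro conjI; elim conjE) (erule has_value_unique, (rule vals)+)+
  ultimately show ?thesis using R by simp
qed

lemma w3_val:
  assumes n: "normalized \<alpha>" and t: "t \<noteq> 0" "t \<noteq> 1" and P: "P = point \<alpha> x y z w t"
    and vx: "has_value (W3 \<x>) P x'" and vy: "has_value (W3 \<y>) P y'"
    and vz: "has_value (W3 \<z>) P z'" and vw: "has_value (W3 \<w>) P w'"
    and vt: "has_value (W3 \<t>) P t'"
    and va: "\<forall>i\<le>6. has_value (W3 (params ! i)) P (\<alpha>' i)"
  shows "x * z - 1 \<noteq> 0 \<and> x' = x \<and> y' = y - \<alpha> 3 * z / (x * z - 1) \<and> z' = z \<and>
    w' = w - \<alpha> 3 * x / (x * z - 1) \<and> t' = 1 * t + 0 \<and> (\<forall>i\<le>6. \<alpha>' i = A3 \<alpha> i)"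
proof -
  note vals = has_value_intros has_value_point has_value_point_a0[OF n]
  have R: "x * z - 1 \<noteq> 0"
  proof
    assume "x * z - 1 = 0"
    \<comment> \<open>The slope in direction \<open>\<alpha> 3\<close> is \<open>- z\<close>; its
      vanishing contradicts \<open>x * z = 1\<close>.\<close>
    have "- (\<alpha> 3 * z) = (0::complex) \<and> - z = (0::complex)"
    proof (rule has_value_denominator[OF vy[unfolded P w3_images(2)]])
      show "has_value (\<x> * \<z> - 1) (point (\<lambda>i. \<alpha> i + s * (if i = 3 then 1 else 0)) x y z w t) 0"
        for s
        by (rule has_value_cong, (rule has_value_intros has_value_point has_value_a0)+)
          (use \<open>x * z - 1 = 0\<close> in simp)
      show "has_value (\<y> * (\<x> * \<z> - 1) - \<a>3 * \<z>)
        (point (\<lambda>i. \<alpha> i + s * (if i = 3 then 1 else 0)) x y z w t) (- (\<alpha> 3 * z) + s * (- z))" for s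
        by (rule has_value_cong, (rule has_value_intros has_value_point has_value_a0)+)
          (use \<open>x * z - 1 = 0\<close> in \<open>simp add: algebra_simps\<close>)
    qed (simp add: nonzero left_diff_distrib distrib_right)
    then show False using \<open>x * z - 1 = 0\<close> t by simp
  qed
  have "x' = x"
    by (rule has_value_unique[OF vx[unfolded P w3_images(1)]]) ((rule vals) |
      (use R t in \<open>simp; fail\<close>))+
  moreover
  have "y' = y - \<alpha> 3 * z / (x * z - 1)"
    by (rule has_value_unique[OF vy[unfolded P w3_images(2)]]) ((rule vals) |
      (use R t in \<open>simp; fail\<close>))+
  moreover
  have "z' = z"
    by (rule has_value_unique[OF vz[unfolded P w3_images(3)]]) ((rule vals) |
      (use R t in \<open>simp; fail\<close>))+
  moreover
  have "w' = w - \<alpha> 3 * x / (x * z - 1)"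
    by (rule has_value_unique[OF vw[unfolded P w3_images(4)]]) ((rule vals) |
      (use R t in \<open>simp; fail\<close>))+
  moreover
  have "t' = t"
    by (rule has_value_unique[OF vt[unfolded P w3_images(5)]]) (rule vals)+
  moreover have "\<forall>i\<le>6. \<alpha>' i = A3 \<alpha> i"
    using va unfolding all_le_6 params_nth P w3_images(6-12) A3_nth
    by (intro conjI; elim conjE) (erule has_value_unique, (rule vals)+)+
  ultimately show ?thesis using R by simp
qed

lemma w4_val:
  assumes n: "normalized \<alpha>" and t: "t \<noteq> 0" "t \<noteq> 1" and P: "P = point \<alpha> x y z w t"
    and vx: "has_value (W4 \<x>) P x'" and vy: "has_value (W4 \<y>) P y'"
    and vz: "has_value (W4 \<z>) P z'" and vw: "has_value (W4 \<w>) P w'"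
    and vt: "has_value (W4 \<t>) P t'"
    and va: "\<forall>i\<le>6. has_value (W4 (params ! i)) P (\<alpha>' i)"
  shows "w \<noteq> 0 \<and> x' = x \<and> y' = y \<and> z' = z + \<alpha> 4 / w \<and>
    w' = w \<and> t' = 1 * t + 0 \<and> (\<forall>i\<le>6. \<alpha>' i = A4 \<alpha> i)"
proof -
  note vals = has_value_intros has_value_point has_value_point_a0[OF n]
  have R: "w \<noteq> 0"
  proof
    assume "w = 0"
    have "\<alpha> 4 = (0::complex) \<and> 1 = (0::complex)"
    proof (rule has_value_denominator[OF vz[unfolded P w4_images(3)]])
      show "has_value \<w> (point (\<lambda>i. \<alpha> i + s * (if i = 4 then 1 else 0)) x y z w t) 0" for s
        by (rule has_value_cong, (rule has_value_intros has_value_point has_value_a0)+) (use \<open>w =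
          0\<close> in simp)
      show "has_value (\<z> * \<w> + \<a>4)
        (point (\<lambda>i. \<alpha> i + s * (if i = 4 then 1 else 0)) x y z w t) (\<alpha> 4 + s * 1)" for s
        by (rule has_value_cong, (rule has_value_intros has_value_point has_value_a0)+)
          (use \<open>w = 0\<close> in \<open>simp add: algebra_simps\<close>)
    qed (simp add: nonzero left_diff_distrib distrib_right)
    then show False using \<open>w = 0\<close> t by simp
  qed
  have "x' = x"
    by (rule has_value_unique[OF vx[unfolded P w4_images(1)]]) ((rule vals) |
      (use R t in \<open>simp; fail\<close>))+
  moreover
  have "y' = y"
    by (rule has_value_unique[OF vy[unfolded P w4_images(2)]]) ((rule vals) |
      (use R t in \<open>simp; fail\<close>))+
  moreover
  have "z' = z + \<alpha> 4 / w"
    by (rule has_value_unique[OF vz[unfolded P w4_images(3)]]) ((rule vals) |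
      (use R t in \<open>simp; fail\<close>))+
  moreover
  have "w' = w"
    by (rule has_value_unique[OF vw[unfolded P w4_images(4)]]) ((rule vals) |
      (use R t in \<open>simp; fail\<close>))+
  moreover
  have "t' = t"
    by (rule has_value_unique[OF vt[unfolded P w4_images(5)]]) (rule vals)+
  moreover have "\<forall>i\<le>6. \<alpha>' i = A4 \<alpha> i"
    using va unfolding all_le_6 params_nth P w4_images(6-12) A4_nth
    by (intro conjI; elim conjE) (erule has_value_unique, (rule vals)+)+
  ultimately show ?thesis using R by simp
qed

lemma w5_val:
  assumes n: "normalized \<alpha>" and t: "t \<noteq> 0" "t \<noteq> 1" and P: "P = point \<alpha> x y z w t"
    and vx: "has_value (W5 \<x>) P x'" and vy: "has_value (W5 \<y>) P y'"
    and vz: "has_value (W5 \<z>) P z'" and vw: "has_value (W5 \<w>) P w'"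
    and vt: "has_value (W5 \<t>) P t'"
    and va: "\<forall>i\<le>6. has_value (W5 (params ! i)) P (\<alpha>' i)"
  shows "True \<and> x' = x \<and> y' = y \<and> z' = z \<and>
    w' = w \<and> t' = 1 * t + 0 \<and> (\<forall>i\<le>6. \<alpha>' i = A5 \<alpha> i)"
proof -
  note vals = has_value_intros has_value_point has_value_point_a0[OF n]
  have "x' = x"
    by (rule has_value_unique[OF vx[unfolded P w5_images(1)]]) ((rule vals) |
      (use t t in \<open>simp; fail\<close>))+
  moreover
  have "y' = y"
    by (rule has_value_unique[OF vy[unfolded P w5_images(2)]]) ((rule vals) |
      (use t t in \<open>simp; fail\<close>))+
  moreover
  have "z' = z"
    by (rule has_value_unique[OF vz[unfolded P w5_images(3)]]) ((rule vals) |
      (use t t in \<open>simp; fail\<close>))+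
  moreover
  have "w' = w"
    by (rule has_value_unique[OF vw[unfolded P w5_images(4)]]) ((rule vals) |
      (use t t in \<open>simp; fail\<close>))+
  moreover
  have "t' = t"
    by (rule has_value_unique[OF vt[unfolded P w5_images(5)]]) (rule vals)+
  moreover have "\<forall>i\<le>6. \<alpha>' i = A5 \<alpha> i"
    using va unfolding all_le_6 params_nth P w5_images(6-12) A5_nth
    by (intro conjI; elim conjE) (erule has_value_unique, (rule vals)+)+
  ultimately show ?thesis by simp
qed

lemma w6_val:
  assumes n: "normalized \<alpha>" and t: "t \<noteq> 0" "t \<noteq> 1" and P: "P = point \<alpha> x y z w t"
    and vx: "has_value (W6 \<x>) P x'" and vy: "has_value (W6 \<y>) P y'"
    and vz: "has_value (W6 \<z>) P z'" and vw: "has_value (W6 \<w>) P w'"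
    and vt: "has_value (W6 \<t>) P t'"
    and va: "\<forall>i\<le>6. has_value (W6 (params ! i)) P (\<alpha>' i)"
  shows "z - 1 \<noteq> 0 \<and> x' = 1 - x \<and> y' = - y \<and> z' = z / (z - 1) \<and>
    w' = - ((z - 1) * ((z - 1) * w + \<alpha> 4)) \<and> t' = (- 1) * t + 1 \<and> (\<forall>i\<le>6. \<alpha>' i = A6 \<alpha> i)"
proof -
  note vals = has_value_intros has_value_point has_value_point_a0[OF n]
  have R: "z - 1 \<noteq> 0"
  proof
    assume "z - 1 = 0"
    \<comment> \<open>The numerator \<open>\<z>\<close> has the constant value 1 on
      \<open>z = 1\<close>, so here the constant term gives the contradiction.\<close>
    have "1 = (0::complex) \<and> 0 = (0::complex)"
    proof (rule has_value_denominator[OF vz[unfolded P w6_images(3)]])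
      show "has_value (\<z> - 1) (point (\<lambda>i. \<alpha> i + s * (if i = 1 then 1 else 0)) x y z w t) 0" for s
        by (rule has_value_cong, (rule has_value_intros has_value_point has_value_a0)+)
          (use \<open>z - 1 = 0\<close> in simp)
      show "has_value \<z> (point (\<lambda>i. \<alpha> i + s * (if i = 1 then 1 else 0)) x y z w t) (1 + s * 0)"
        for s
        by (rule has_value_cong, (rule has_value_intros has_value_point has_value_a0)+)
          (use \<open>z - 1 = 0\<close> in \<open>simp add: algebra_simps\<close>)
    qed (simp add: nonzero)
    then show False using \<open>z - 1 = 0\<close> t by simp
  qed
  have "x' = 1 - x"
    by (rule has_value_unique[OF vx[unfolded P w6_images(1)]]) ((rule vals) |
      (use R t in \<open>simp; fail\<close>))+
  moreover
  have "y' = - y"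
    by (rule has_value_unique[OF vy[unfolded P w6_images(2)]]) ((rule vals) |
      (use R t in \<open>simp; fail\<close>))+
  moreover
  have "z' = z / (z - 1)"
    by (rule has_value_unique[OF vz[unfolded P w6_images(3)]]) ((rule vals) |
      (use R t in \<open>simp; fail\<close>))+
  moreover
  have "w' = - ((z - 1) * ((z - 1) * w + \<alpha> 4))"
    by (rule has_value_unique[OF vw[unfolded P w6_images(4)]]) ((rule vals) |
      (use R t in \<open>simp; fail\<close>))+
  moreover
  have "t' = 1 - t"
    by (rule has_value_unique[OF vt[unfolded P w6_images(5)]]) (rule vals)+
  moreover have "\<forall>i\<le>6. \<alpha>' i = A6 \<alpha> i"
    using va unfolding all_le_6 params_nth P w6_images(6-12) A6_nth
    by (intro conjI; elim conjE) (erule has_value_unique, (rule vals)+)+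
  ultimately show ?thesis using R by simp
qed

lemma psi_val:
  assumes n: "normalized \<alpha>" and t: "t \<noteq> 0" "t \<noteq> 1" and P: "P = point \<alpha> x y z w t"
    and vx: "has_value (\<Psi> \<x>) P x'" and vy: "has_value (\<Psi> \<y>) P y'"
    and vz: "has_value (\<Psi> \<z>) P z'" and vw: "has_value (\<Psi> \<w>) P w'"
    and vt: "has_value (\<Psi> \<t>) P t'"
    and va: "\<forall>i\<le>6. has_value (\<Psi> (params ! i)) P (\<alpha>' i)"
  shows "x \<noteq> t \<and> x' = (t - 1) * x / (t - x) \<and> y' = (t - x) * ((t - x) * y - \<alpha> 2) / (t * (t - 1)) \<and>
    z' = (t * z - 1) / (t - 1) \<and>
    w' = (t - 1) * w / t \<and> t' = (- 1) * t + 1 \<and> (\<forall>i\<le>6. \<alpha>' i = A_psi \<alpha> i)"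
proof -
  note vals = has_value_intros has_value_point has_value_point_a0[OF n]
  have R: "x \<noteq> t"
  proof
    assume "x = t"
    \<comment> \<open>On \<open>x = t\<close> the numerator has the value
      \<open>(t - 1) * t\<close>, nonzero because the times 0 and 1 are excluded.\<close>
    have "(t - 1) * t = (0::complex) \<and> 0 = (0::complex)"
    proof (rule has_value_denominator[OF vx[unfolded P psi_images(1)]])
      show "has_value (\<t> - \<x>) (point (\<lambda>i. \<alpha> i + s * (if i = 1 then 1 else 0)) x y z w t) 0" for s
        by (rule has_value_cong, (rule has_value_intros has_value_point has_value_a0)+) (use \<open>x =
          t\<close> in simp)
      show "has_value ((\<t> - 1) * \<x>)
        (point (\<lambda>i. \<alpha> i + s * (if i = 1 then 1 else 0)) x y z w t) ((t - 1) * t + s * 0)" for s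
        by (rule has_value_cong, (rule has_value_intros has_value_point has_value_a0)+)
          (use \<open>x = t\<close> in \<open>simp add: algebra_simps\<close>)
    qed (simp add: nonzero)
    then show False using \<open>x = t\<close> t by simp
  qed
  have "x' = (t - 1) * x / (t - x)"
    by (rule has_value_unique[OF vx[unfolded P psi_images(1)]]) ((rule vals) |
      (use R t in \<open>simp; fail\<close>))+
  moreover
  have "y' = (t - x) * ((t - x) * y - \<alpha> 2) / (t * (t - 1))"
    by (rule has_value_unique[OF vy[unfolded P psi_images(2)]]) ((rule vals) |
      (use R t in \<open>simp; fail\<close>))+
  moreover
  have "z' = (t * z - 1) / (t - 1)"
    by (rule has_value_unique[OF vz[unfolded P psi_images(3)]]) ((rule vals) |
      (use R t in \<open>simp; fail\<close>))+
  moreover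
  have "w' = (t - 1) * w / t"
    by (rule has_value_unique[OF vw[unfolded P psi_images(4)]]) ((rule vals) |
      (use R t in \<open>simp; fail\<close>))+
  moreover
  have "t' = 1 - t"
    by (rule has_value_unique[OF vt[unfolded P psi_images(5)]]) (rule vals)+
  moreover have "\<forall>i\<le>6. \<alpha>' i = A_psi \<alpha> i"
    using va unfolding all_le_6 params_nth P psi_images(6-12) A_psi_nth
    by (intro conjI; elim conjE) (erule has_value_unique, (rule vals)+)+
  ultimately show ?thesis using R by simp
qed

section \<open>Derivatives of the transformed coordinates along a curve\<close>

context
  fixes x y z w :: "complex \<Rightarrow> complex" and t a b c d k :: complex
  assumes x: "(x has_field_derivative a) (at t)" and y: "(y has_field_derivative b) (at t)"
    and z: "(z has_field_derivative c) (at t)" and w: "(w has_field_derivative d) (at t)"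
begin

text \<open>In this context \<open>k\<close> is the parameter of the transformation. The derivatives
  \<open>a\<close>, \<open>b\<close>, \<open>c\<close>, \<open>d\<close> stay abstract so that the
  quotient rule is applied without the large expressions of the vector field.\<close>

lemma derivative_w0_y:
  assumes "x t \<noteq> t"
  shows "((\<lambda>s. y s - k / (x s - s)) has_field_derivative b + k * (a - 1) / (x t - t)\<^sup>2) (at t)"
  by (rule DERIV_cong, (rule x y derivative_intros | (use assms in \<open>simp; fail\<close>))+)
    (use assms in \<open>simp add: divide_simps power2_eq_square\<close>)

lemma derivative_w2_x:
  assumes "y t \<noteq> 0"
  shows "((\<lambda>s. x s + k / y s) has_field_derivative a - k * b / (y t)\<^sup>2) (at t)"
  by (rule DERIV_cong, (rule x y derivative_intros | (use assms in \<open>simp; fail\<close>))+)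
    (use assms in \<open>simp add: divide_simps power2_eq_square\<close>)

lemma derivative_w4_z:
  assumes "w t \<noteq> 0"
  shows "((\<lambda>s. z s + k / w s) has_field_derivative c - k * d / (w t)\<^sup>2) (at t)"
  by (rule DERIV_cong, (rule z w derivative_intros | (use assms in \<open>simp; fail\<close>))+)
    (use assms in \<open>simp add: divide_simps power2_eq_square\<close>)

lemma derivative_w3_y:
  assumes "x t * z t - 1 \<noteq> 0"
  shows "((\<lambda>s. y s - k * z s / (x s * z s - 1)) has_field_derivative
    b + k * (c + (z t)\<^sup>2 * a) / (x t * z t - 1)\<^sup>2) (at t)"
  by (rule DERIV_cong, (rule x y z derivative_intros | (use assms in \<open>simp; fail\<close>))+)
    (use assms in \<open>simp add: divide_simps power2_eq_square\<close>, use assms in \<open>simp add: algebra_simps\<close>)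

lemma derivative_w3_w:
  assumes "x t * z t - 1 \<noteq> 0"
  shows "((\<lambda>s. w s - k * x s / (x s * z s - 1)) has_field_derivative
    d + k * (a + (x t)\<^sup>2 * c) / (x t * z t - 1)\<^sup>2) (at t)"
  by (rule DERIV_cong, (rule x w z derivative_intros | (use assms in \<open>simp; fail\<close>))+)
    (use assms in \<open>simp add: divide_simps power2_eq_square\<close>, use assms in \<open>simp add: algebra_simps\<close>)

lemma derivative_w6_z:
  assumes "z t - 1 \<noteq> 0"
  shows "((\<lambda>s. z s / (z s - 1)) has_field_derivative - c / (z t - 1)\<^sup>2) (at t)"
  by (rule DERIV_cong, (rule z derivative_intros | (use assms in \<open>simp; fail\<close>))+)
    (use assms in \<open>simp add: divide_simps power2_eq_square\<close>, use assms in \<open>simp add: algebra_simps\<close>)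

lemma derivative_w6_w:
  "((\<lambda>s. - ((z s - 1) * ((z s - 1) * w s + k))) has_field_derivative
    - ((z t - 1)\<^sup>2 * d + (2 * (z t - 1) * w t + k) * c)) (at t)"
  by (rule DERIV_cong, (rule z w derivative_intros)+) (simp add: algebra_simps power2_eq_square)

lemma derivative_psi_x:
  assumes "x t \<noteq> t"
  shows "((\<lambda>s. (s - 1) * x s / (s - x s)) has_field_derivative
    ((x t + (t - 1) * a) * (t - x t) - (t - 1) * x t * (1 - a)) / (t - x t)\<^sup>2) (at t)"
  by (rule DERIV_cong, (rule x derivative_intros | (use assms in \<open>simp; fail\<close>))+)
    (use assms in \<open>simp add: power2_eq_square mult.commute\<close>)

lemma derivative_psi_y:
  assumes "t \<noteq> 0" "t \<noteq> 1"
  shows "((\<lambda>s. (s - x s) * ((s - x s) * y s - k) / (s * (s - 1))) has_field_derivative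
    ((1 - a) * (2 * (t - x t) * y t - k) + (t - x t)\<^sup>2 * b) / (t * (t - 1)) -
    (t - x t) * ((t - x t) * y t - k) * (2 * t - 1) / (t * (t - 1))\<^sup>2) (at t)"
  by (rule DERIV_cong, (rule x y derivative_intros | (use assms in \<open>simp; fail\<close>))+)
    (use assms in \<open>simp add: divide_simps power2_eq_square\<close>, algebra)

lemma derivative_psi_z:
  assumes "t \<noteq> 1"
  shows "((\<lambda>s. (s * z s - 1) / (s - 1))
    has_field_derivative (t * (t - 1) * c + 1 - z t) / (t - 1)\<^sup>2) (at t)"
  by (rule DERIV_cong, (rule z derivative_intros | (use assms in \<open>simp; fail\<close>))+)
    (use assms in \<open>simp add: divide_simps power2_eq_square\<close>, use assms in \<open>simp add: algebra_simps\<close>)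

lemma derivative_psi_w:
  assumes "t \<noteq> 0"
  shows "((\<lambda>s. (s - 1) * w s / s) has_field_derivative w t / t\<^sup>2 + (t - 1) * d / t) (at t)"
  by (rule DERIV_cong, (rule w derivative_intros | (use assms in \<open>simp; fail\<close>))+)
    (use assms in \<open>simp add: divide_simps power2_eq_square\<close>, use assms in \<open>simp add: algebra_simps\<close>)

end

section \<open>Each generator carries solutions to solutions\<close>

lemma w0_flow_at:
  assumes n: "normalized \<alpha>" and t: "t \<noteq> 0" "t \<noteq> 1" and R: "x t \<noteq> t"
    and "flow_at \<alpha> (x t) (y t) (z t) (w t) 1 x y z w t t"
  shows "flow_at (A0 \<alpha>) (x t) (y t - \<alpha> 0 / (x t - t))
    (z t) (w t) 1
    (\<lambda>s. x s) (\<lambda>s. y s - \<alpha> 0 / (x s - s))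
    (\<lambda>s. z s) (\<lambda>s. w s) (1 * t + 0) t"
proof -
  let ?fx = "fx \<alpha> (x t) (y t) (z t) (w t) t" and ?fy = "fy \<alpha> (x t) (y t) (z t) (w t) t"
    and ?fz = "fz \<alpha> (x t) (y t) (z t) (w t) t" and ?fw = "fw \<alpha> (x t) (y t) (z t) (w t) t"
  have flow: "(x has_field_derivative ?fx / (t * (t - 1))) (at t)"
    "(y has_field_derivative ?fy / (t * (t - 1))) (at t)"
    "(z has_field_derivative ?fz / (t * (t - 1))) (at t)"
    "(w has_field_derivative ?fw / (t * (t - 1))) (at t)"
    using assms(5) by (simp_all add: flow_at_def)
  \<comment> \<open>\<open>u\<close> is the quotient frozen at the time \<open>t\<close>, which is
    all that \<open>w0_flow\<close> sees; for differentiation the quotient varies and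
    \<open>\<alpha> 0\<close> is the constant.\<close>
  define u where "u = \<alpha> 0 / (x t - t)"
  have u: "\<alpha> 0 = u * (x t - t)" using R by (simp add: u_def)
  note F = w0_flow[OF n u, of "y t" "z t" "w t"]
  have "fy (A0 \<alpha>) (x t) (y t - u) (z t) (w t) t = ?fy + u * (?fx - t * (t - 1)) / (x t - t)"
    using F(2) R by (simp add: field_simps)
  \<comment> \<open>This identifies the result of \<open>derivative_w0_y\<close> with the second
    component of the new vector field.\<close>
  then have Y: "?fy / (t * (t - 1)) + \<alpha> 0 * (?fx / (t * (t - 1)) - 1) / (x t - t)\<^sup>2 =
      fy (A0 \<alpha>) (x t) (y t - u) (z t) (w t) t / (t * (t - 1))"
    unfolding u using R t by (simp add: divide_simps power2_eq_square)
  show ?thesis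
    unfolding flow_at_def u_def[symmetric]
    using flow derivative_w0_y[OF flow R, of "\<alpha> 0", unfolded Y] by (simp add: F)
qed

lemma baecklund_w0: "baecklund W0"
proof (rule baecklundI[where k = "1" and d = 0 and A = A0 and R = "\<lambda>x y z w t. x \<noteq> t"
      and X = "\<lambda>\<alpha> x y z w t. x" and Y = "\<lambda>\<alpha> x y z w t. y - \<alpha> 0 / (x - t)"
      and Z = "\<lambda>\<alpha> x y z w t. z" and W = "\<lambda>\<alpha> x y z w t. w"])
  show "field_automorphism W0"
    unfolding W0_def by (rule w0.field_automorphism_subst)
  show "W0 ` set params \<subseteq> param_field"
    by (simp add: params_def w0_images param_field_intros)
\<comment> \<open>The remaining premises of \<open>baecklundI\<close> are
  \<open>k \<noteq> 0\<close>, \<open>val\<close> and \<open>der\<close>.\<close>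
qed (simp, (rule w0_val w0_flow_at; assumption)+)

lemma w1_flow_at:
  assumes n: "normalized \<alpha>" and t: "t \<noteq> 0" "t \<noteq> 1" and R: "True"
    and "flow_at \<alpha> (x t) (y t) (z t) (w t) 1 x y z w t t"
  shows "flow_at (A1 \<alpha>) (x t) (y t)
    (z t) (w t) 1
    (\<lambda>s. x s) (\<lambda>s. y s)
    (\<lambda>s. z s) (\<lambda>s. w s) (1 * t + 0) t"
proof -
  let ?fx = "fx \<alpha> (x t) (y t) (z t) (w t) t" and ?fy = "fy \<alpha> (x t) (y t) (z t) (w t) t"
    and ?fz = "fz \<alpha> (x t) (y t) (z t) (w t) t" and ?fw = "fw \<alpha> (x t) (y t) (z t) (w t) t"
  have flow: "(x has_field_derivative ?fx / (t * (t - 1))) (at t)"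
    "(y has_field_derivative ?fy / (t * (t - 1))) (at t)"
    "(z has_field_derivative ?fz / (t * (t - 1))) (at t)"
    "(w has_field_derivative ?fw / (t * (t - 1))) (at t)"
    using assms(5) by (simp_all add: flow_at_def)
  show ?thesis unfolding flow_at_def using flow by (simp add: w1_flow)
qed

lemma baecklund_w1: "baecklund W1"
proof (rule baecklundI[where k = "1" and d = 0 and A = A1 and R = "\<lambda>x y z w t. True"
      and X = "\<lambda>\<alpha> x y z w t. x" and Y = "\<lambda>\<alpha> x y z w t. y"
      and Z = "\<lambda>\<alpha> x y z w t. z" and W = "\<lambda>\<alpha> x y z w t. w"])
  show "field_automorphism W1"
    unfolding W1_def by (rule w1.field_automorphism_subst)
  show "W1 ` set params \<subseteq> param_field"
    by (simp add: params_def w1_images param_field_intros)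
qed (simp, (rule w1_val w1_flow_at; assumption)+)

lemma w2_flow_at:
  assumes n: "normalized \<alpha>" and t: "t \<noteq> 0" "t \<noteq> 1" and R: "y t \<noteq> 0"
    and "flow_at \<alpha> (x t) (y t) (z t) (w t) 1 x y z w t t"
  shows "flow_at (A2 \<alpha>) (x t + \<alpha> 2 / y t) (y t)
    (z t) (w t) 1
    (\<lambda>s. x s + \<alpha> 2 / y s) (\<lambda>s. y s)
    (\<lambda>s. z s) (\<lambda>s. w s) (1 * t + 0) t"
proof -
  let ?fx = "fx \<alpha> (x t) (y t) (z t) (w t) t" and ?fy = "fy \<alpha> (x t) (y t) (z t) (w t) t"
    and ?fz = "fz \<alpha> (x t) (y t) (z t) (w t) t" and ?fw = "fw \<alpha> (x t) (y t) (z t) (w t) t"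
  have flow: "(x has_field_derivative ?fx / (t * (t - 1))) (at t)"
    "(y has_field_derivative ?fy / (t * (t - 1))) (at t)"
    "(z has_field_derivative ?fz / (t * (t - 1))) (at t)"
    "(w has_field_derivative ?fw / (t * (t - 1))) (at t)"
    using assms(5) by (simp_all add: flow_at_def)
  define u where "u = \<alpha> 2 / y t"
  have u: "\<alpha> 2 = u * y t" using R by (simp add: u_def)
  note F = w2_flow[OF n u, of "x t" "z t" "w t" t]
  have X: "?fx / (t * (t - 1)) - \<alpha> 2 * (?fy / (t * (t - 1))) / (y t)\<^sup>2 =
      fx (A2 \<alpha>) (x t + u) (y t) (z t) (w t) t / (t * (t - 1))"
    using F(1) R t unfolding u by (simp add: divide_simps power2_eq_square) (simp add: algebra_simps)
  show ?thesis
    unfolding flow_at_def u_def[symmetric]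
    using flow derivative_w2_x[OF flow R, of "\<alpha> 2", unfolded X] by (simp add: F)
qed

lemma baecklund_w2: "baecklund W2"
proof (rule baecklundI[where k = "1" and d = 0 and A = A2 and R = "\<lambda>x y z w t. y \<noteq> 0"
      and X = "\<lambda>\<alpha> x y z w t. x + \<alpha> 2 / y" and Y = "\<lambda>\<alpha> x y z w t. y"
      and Z = "\<lambda>\<alpha> x y z w t. z" and W = "\<lambda>\<alpha> x y z w t. w"])
  show "field_automorphism W2"
    unfolding W2_def by (rule w2.field_automorphism_subst)
  show "W2 ` set params \<subseteq> param_field"
    by (simp add: params_def w2_images param_field_intros)
qed (simp, (rule w2_val w2_flow_at; assumption)+)

lemma w3_flow_at:
  assumes n: "normalized \<alpha>" and t: "t \<noteq> 0" "t \<noteq> 1" and R: "x t * z t - 1 \<noteq> 0"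
    and "flow_at \<alpha> (x t) (y t) (z t) (w t) 1 x y z w t t"
  shows "flow_at (A3 \<alpha>) (x t) (y t - \<alpha> 3 * z t / (x t * z t - 1))
    (z t) (w t - \<alpha> 3 * x t / (x t * z t - 1)) 1
    (\<lambda>s. x s) (\<lambda>s. y s - \<alpha> 3 * z s / (x s * z s - 1))
    (\<lambda>s. z s) (\<lambda>s. w s - \<alpha> 3 * x s / (x s * z s - 1)) (1 * t + 0) t"
proof -
  let ?fx = "fx \<alpha> (x t) (y t) (z t) (w t) t" and ?fy = "fy \<alpha> (x t) (y t) (z t) (w t) t"
    and ?fz = "fz \<alpha> (x t) (y t) (z t) (w t) t" and ?fw = "fw \<alpha> (x t) (y t) (z t) (w t) t"
  have flow: "(x has_field_derivative ?fx / (t * (t - 1))) (at t)"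
    "(y has_field_derivative ?fy / (t * (t - 1))) (at t)"
    "(z has_field_derivative ?fz / (t * (t - 1))) (at t)"
    "(w has_field_derivative ?fw / (t * (t - 1))) (at t)"
    using assms(5) by (simp_all add: flow_at_def)
  \<comment> \<open>Kept opaque so that clearing fractions does not multiply out the
    denominator.\<close>
  define e where "e = x t * z t - 1"
  define u where "u = \<alpha> 3 / e"
  have e: "e \<noteq> 0" using R by (simp add: e_def)
  have u: "\<alpha> 3 = u * (x t * z t - 1)" using e by (simp add: u_def flip: e_def)
  note F = w3_flow[OF n u, of "y t" "w t" t, folded e_def]
  have Y: "?fy / (t * (t - 1)) + \<alpha> 3 * (?fz / (t * (t - 1)) + (z t)\<^sup>2 * (?fx / (t * (t - 1)))) / e\<^sup>2 =
      fy (A3 \<alpha>) (x t) (y t - u * z t) (z t) (w t - u * x t) t / (t * (t - 1))"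
    using F(2) e t unfolding u e_def[symmetric]
    by (simp add: divide_simps power2_eq_square) (simp add: algebra_simps)
  have W: "?fw / (t * (t - 1)) + \<alpha> 3 * (?fx / (t * (t - 1)) + (x t)\<^sup>2 * (?fz / (t * (t - 1)))) / e\<^sup>2 =
      fw (A3 \<alpha>) (x t) (y t - u * z t) (z t) (w t - u * x t) t / (t * (t - 1))"
    using F(4) e t unfolding u e_def[symmetric]
    by (simp add: divide_simps power2_eq_square) (simp add: algebra_simps)
  have uu: "\<alpha> 3 * s / e = u * s" for s by (simp add: u_def)
  show ?thesis
    unfolding flow_at_def e_def[symmetric] uu mult_1 mult_1_left add_0_right F(1,3) Y[symmetric] W[symmetric]
    using flow derivative_w3_y[OF flow R, of "\<alpha> 3"] derivative_w3_w[OF flow R, of "\<alpha> 3"]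
    unfolding e_def[symmetric] by (intro conjI)
qed

lemma baecklund_w3: "baecklund W3"
proof (rule baecklundI[where k = "1" and d = 0 and A = A3 and R = "\<lambda>x y z w t. x * z - 1 \<noteq> 0"
      and X = "\<lambda>\<alpha> x y z w t. x" and Y = "\<lambda>\<alpha> x y z w t. y - \<alpha> 3 * z / (x * z - 1)"
      and Z = "\<lambda>\<alpha> x y z w t. z" and W = "\<lambda>\<alpha> x y z w t. w - \<alpha> 3 * x / (x * z - 1)"])
  show "field_automorphism W3"
    unfolding W3_def by (rule w3.field_automorphism_subst)
  show "W3 ` set params \<subseteq> param_field"
    by (simp add: params_def w3_images param_field_intros)
qed (simp, (rule w3_val w3_flow_at; assumption)+)

lemma w4_flow_at:
  assumes n: "normalized \<alpha>" and t: "t \<noteq> 0" "t \<noteq> 1" and R: "w t \<noteq> 0"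
    and "flow_at \<alpha> (x t) (y t) (z t) (w t) 1 x y z w t t"
  shows "flow_at (A4 \<alpha>) (x t) (y t)
    (z t + \<alpha> 4 / w t) (w t) 1
    (\<lambda>s. x s) (\<lambda>s. y s)
    (\<lambda>s. z s + \<alpha> 4 / w s) (\<lambda>s. w s) (1 * t + 0) t"
proof -
  let ?fx = "fx \<alpha> (x t) (y t) (z t) (w t) t" and ?fy = "fy \<alpha> (x t) (y t) (z t) (w t) t"
    and ?fz = "fz \<alpha> (x t) (y t) (z t) (w t) t" and ?fw = "fw \<alpha> (x t) (y t) (z t) (w t) t"
  have flow: "(x has_field_derivative ?fx / (t * (t - 1))) (at t)"
    "(y has_field_derivative ?fy / (t * (t - 1))) (at t)"
    "(z has_field_derivative ?fz / (t * (t - 1))) (at t)"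
    "(w has_field_derivative ?fw / (t * (t - 1))) (at t)"
    using assms(5) by (simp_all add: flow_at_def)
  define u where "u = \<alpha> 4 / w t"
  have u: "\<alpha> 4 = u * w t" using R by (simp add: u_def)
  note F = w4_flow[OF n u, of "x t" "y t" "z t" t]
  have Z: "?fz / (t * (t - 1)) - \<alpha> 4 * (?fw / (t * (t - 1))) / (w t)\<^sup>2 =
      fz (A4 \<alpha>) (x t) (y t) (z t + u) (w t) t / (t * (t - 1))"
    using F(3) R t unfolding u by (simp add: divide_simps power2_eq_square) (simp add: algebra_simps)
  show ?thesis
    unfolding flow_at_def u_def[symmetric]
    using flow derivative_w4_z[OF flow R, of "\<alpha> 4", unfolded Z] by (simp add: F)
qed

lemma baecklund_w4: "baecklund W4"
proof (rule baecklundI[where k = "1" and d = 0 and A = A4 and R = "\<lambda>x y z w t. w \<noteq> 0"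
      and X = "\<lambda>\<alpha> x y z w t. x" and Y = "\<lambda>\<alpha> x y z w t. y"
      and Z = "\<lambda>\<alpha> x y z w t. z + \<alpha> 4 / w" and W = "\<lambda>\<alpha> x y z w t. w"])
  show "field_automorphism W4"
    unfolding W4_def by (rule w4.field_automorphism_subst)
  show "W4 ` set params \<subseteq> param_field"
    by (simp add: params_def w4_images param_field_intros)
qed (simp, (rule w4_val w4_flow_at; assumption)+)

lemma w5_flow_at:
  assumes n: "normalized \<alpha>" and t: "t \<noteq> 0" "t \<noteq> 1" and R: "True"
    and "flow_at \<alpha> (x t) (y t) (z t) (w t) 1 x y z w t t"
  shows "flow_at (A5 \<alpha>) (x t) (y t)
    (z t) (w t) 1
    (\<lambda>s. x s) (\<lambda>s. y s)
    (\<lambda>s. z s) (\<lambda>s. w s) (1 * t + 0) t"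
proof -
  let ?fx = "fx \<alpha> (x t) (y t) (z t) (w t) t" and ?fy = "fy \<alpha> (x t) (y t) (z t) (w t) t"
    and ?fz = "fz \<alpha> (x t) (y t) (z t) (w t) t" and ?fw = "fw \<alpha> (x t) (y t) (z t) (w t) t"
  have flow: "(x has_field_derivative ?fx / (t * (t - 1))) (at t)"
    "(y has_field_derivative ?fy / (t * (t - 1))) (at t)"
    "(z has_field_derivative ?fz / (t * (t - 1))) (at t)"
    "(w has_field_derivative ?fw / (t * (t - 1))) (at t)"
    using assms(5) by (simp_all add: flow_at_def)
  show ?thesis unfolding flow_at_def using flow by (simp add: w5_flow)
qed

lemma baecklund_w5: "baecklund W5"
proof (rule baecklundI[where k = "1" and d = 0 and A = A5 and R = "\<lambda>x y z w t. True"
      and X = "\<lambda>\<alpha> x y z w t. x" and Y = "\<lambda>\<alpha> x y z w t. y"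
      and Z = "\<lambda>\<alpha> x y z w t. z" and W = "\<lambda>\<alpha> x y z w t. w"])
  show "field_automorphism W5"
    unfolding W5_def by (rule w5.field_automorphism_subst)
  show "W5 ` set params \<subseteq> param_field"
    by (simp add: params_def w5_images param_field_intros)
qed (simp, (rule w5_val w5_flow_at; assumption)+)

lemma w6_flow_at:
  assumes n: "normalized \<alpha>" and t: "t \<noteq> 0" "t \<noteq> 1" and R: "z t - 1 \<noteq> 0"
    and "flow_at \<alpha> (x t) (y t) (z t) (w t) 1 x y z w t t"
  shows "flow_at (A6 \<alpha>) (1 - x t) (- y t)
    (z t / (z t - 1)) (- ((z t - 1) * ((z t - 1) * w t + \<alpha> 4))) (- 1)
    (\<lambda>s. 1 - x s) (\<lambda>s. - y s)
    (\<lambda>s. z s / (z s - 1)) (\<lambda>s. - ((z s - 1) * ((z s - 1) * w s + \<alpha> 4))) ((- 1) * t + 1) t"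
proof -
  let ?fx = "fx \<alpha> (x t) (y t) (z t) (w t) t" and ?fy = "fy \<alpha> (x t) (y t) (z t) (w t) t"
    and ?fz = "fz \<alpha> (x t) (y t) (z t) (w t) t" and ?fw = "fw \<alpha> (x t) (y t) (z t) (w t) t"
  have flow: "(x has_field_derivative ?fx / (t * (t - 1))) (at t)"
    "(y has_field_derivative ?fy / (t * (t - 1))) (at t)"
    "(z has_field_derivative ?fz / (t * (t - 1))) (at t)"
    "(w has_field_derivative ?fw / (t * (t - 1))) (at t)"
    using assms(5) by (simp_all add: flow_at_def)
  define q where "q = 1 / (z t - 1)"
  have q: "q * (z t - 1) = 1" using R by (simp add: q_def)
  have z: "z t / (z t - 1) = q + 1" using R by (simp add: q_def field_simps)
  have t': "- 1 * t + 1 = 1 - t" "(1 - t) * (1 - t - 1) = t * (t - 1)" by algebra+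
  note F = w6_flow[OF n refl q refl, of "x t" "y t" "w t" t]
  have Z: "- (?fz / (t * (t - 1))) / (z t - 1)\<^sup>2 = - 1 * (q\<^sup>2 * ?fz / (t * (t - 1)))"
    by (simp add: q_def power_divide)
  have W: "- ((z t - 1)\<^sup>2 * (?fw / (t * (t - 1))) + (2 * (z t - 1) * w t + \<alpha> 4) * (?fz / (t * (t - 1)))) =
      - 1 * (((z t - 1)\<^sup>2 * ?fw + (2 * (z t - 1) * w t + \<alpha> 4) * ?fz) / (t * (t - 1)))"
    by (simp add: add_divide_distrib)
  show ?thesis
    unfolding flow_at_def z t' F
  proof (intro conjI)
    show "((\<lambda>s. 1 - x s) has_field_derivative - 1 * (?fx / (t * (t - 1)))) (at t)"
      using flow(1) by (auto intro!: derivative_eq_intros)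
    show "((\<lambda>s. - y s) has_field_derivative - 1 * (?fy / (t * (t - 1)))) (at t)"
      using flow(2) by (auto intro!: derivative_eq_intros)
    show "((\<lambda>s. z s / (z s - 1)) has_field_derivative - 1 * (q\<^sup>2 * ?fz / (t * (t - 1)))) (at t)"
      using derivative_w6_z[OF flow R] unfolding Z .
    show "((\<lambda>s. - ((z s - 1) * ((z s - 1) * w s + \<alpha> 4))) has_field_derivative
        - 1 * (((z t - 1)\<^sup>2 * ?fw + (2 * (z t - 1) * w t + \<alpha> 4) * ?fz) / (t * (t - 1)))) (at t)"
      using derivative_w6_w[OF flow, of "\<alpha> 4"] unfolding W .
  qed
qed

lemma baecklund_w6: "baecklund W6"
proof (rule baecklundI[where k = "(- 1)" and d = 1 and A = A6 and R = "\<lambda>x y z w t. z - 1 \<noteq> 0"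
      and X = "\<lambda>\<alpha> x y z w t. 1 - x" and Y = "\<lambda>\<alpha> x y z w t. - y"
      and Z = "\<lambda>\<alpha> x y z w t. z / (z - 1)" and W =
      "\<lambda>\<alpha> x y z w t. - ((z - 1) * ((z - 1) * w + \<alpha> 4))"])
  show "field_automorphism W6"
    unfolding W6_def by (rule w6.field_automorphism_subst)
  show "W6 ` set params \<subseteq> param_field"
    by (simp add: params_def w6_images param_field_intros)
qed (simp, (rule w6_val w6_flow_at; assumption)+)

lemma psi_flow_at:
  assumes n: "normalized \<alpha>" and t: "t \<noteq> 0" "t \<noteq> 1" and R: "x t \<noteq> t"
    and "flow_at \<alpha> (x t) (y t) (z t) (w t) 1 x y z w t t"
  shows "flow_at (A_psi \<alpha>) ((t - 1) * x t / (t - x t)) ((t - x t) * ((t - x t) * y t - \<alpha> 2) / (t * (t - 1)))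
    ((t * z t - 1) / (t - 1)) ((t - 1) * w t / t) (- 1)
    (\<lambda>s. (s - 1) * x s / (s - x s)) (\<lambda>s. (s - x s) * ((s - x s) * y s - \<alpha> 2) / (s * (s - 1)))
    (\<lambda>s. (s * z s - 1) / (s - 1)) (\<lambda>s. (s - 1) * w s / s) ((- 1) * t + 1) t"
proof -
  let ?fx = "fx \<alpha> (x t) (y t) (z t) (w t) t" and ?fy = "fy \<alpha> (x t) (y t) (z t) (w t) t"
    and ?fz = "fz \<alpha> (x t) (y t) (z t) (w t) t" and ?fw = "fw \<alpha> (x t) (y t) (z t) (w t) t"
  have flow: "(x has_field_derivative ?fx / (t * (t - 1))) (at t)"
    "(y has_field_derivative ?fy / (t * (t - 1))) (at t)"
    "(z has_field_derivative ?fz / (t * (t - 1))) (at t)"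
    "(w has_field_derivative ?fw / (t * (t - 1))) (at t)"
    using assms(5) by (simp_all add: flow_at_def)
  define p r q where "p = 1 / (t - x t)" and "r = 1 / t" and "q = 1 / (t - 1)"
  have pqr: "p * (t - x t) = 1" "r * t = 1" "q * (t - 1) =
    1" using R t by (simp_all add: p_def q_def r_def)
  have t': "- 1 * t + 1 = 1 - t" "(1 - t) * (1 - t - 1) = t * (t - 1)" by algebra+
  let ?X = "(t - 1) * x t / (t - x t)"
  let ?Y = "(t - x t) * ((t - x t) * y t - \<alpha> 2) / (t * (t - 1))"
  let ?Z = "(t * z t - 1) / (t - 1)"
  let ?W = "(t - 1) * w t / t"
  have eqs: "?X = (t - 1) * x t * p" "?Y = (t - x t) * ((t - x t) * y t - \<alpha> 2) * r * q"
    "?Z = (t * z t - 1) * q" "?W = (t - 1) * w t * r"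
    by (simp_all add: p_def q_def r_def)
  note F = psi_flow[OF n pqr eqs]
  have rq: "r * q = 1 / (t * (t - 1))" by (simp add: r_def q_def)
  \<comment> \<open>Stated abstractly to avoid expanding the vector field: \<open>m\<close> is
    \<open>t * (t - 1)\<close>, \<open>f\<close> and \<open>g\<close> are \<open>?fx\<close> and
    \<open>?fy\<close>, \<open>e\<close> is the numerator of \<open>?Y\<close>, \<open>c\<close> is
    \<open>2 * t - 1\<close>, and \<open>a\<close>, \<open>b\<close> are the factors multiplying the
    derivatives.\<close>
  have Y: "((1 - f / m) * a + b * (g / m)) / m - e * c / m\<^sup>2 =
      - 1 * ((e / m * c - 1 / m * ((m - f) * a + b * g)) / m)" if "m \<noteq> 0" for a b c e f g m :: complex
    using that by (simp add: field_simps power2_eq_square)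
  have X: "(x t + (t - 1) * (?fx / (t * (t - 1)))) * (t - x t) - (t - 1) * x t * (1 - ?fx / (t * (t - 1))) =
      - 1 * (((t - 1) * x t * (t * (t - 1) - ?fx) - (x t * t * (t - 1) + (t - 1) * ?fx) * (t - x t)) /
        (t * (t - 1)))"
    using t by (simp add: divide_simps) (simp add: algebra_simps)
  show ?thesis
    unfolding flow_at_def t' F
  proof (intro conjI)
    show "((\<lambda>s. (s - 1) * x s / (s - x s))
      has_field_derivative - 1 * (p\<^sup>2 * ((t - 1) * x t * (t * (t - 1) - ?fx) -
        (x t * t * (t - 1) + (t - 1) * ?fx) * (t - x t)) / (t * (t - 1)))) (at t)"
      by (rule DERIV_cong[OF derivative_psi_x[OF flow R]])
        (unfold X, simp add: p_def power_divide)
    show "((\<lambda>s. (s - x s) * ((s - x s) * y s - \<alpha> 2) / (s * (s - 1))) has_field_derivative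
        - 1 * ((?Y * (2 * t - 1) - r * q * ((t * (t - 1) - ?fx) * (2 * (t - x t) * y t - \<alpha> 2) +
          (t - x t)\<^sup>2 * ?fy)) / (t * (t - 1)))) (at t)"
      by (rule DERIV_cong[OF derivative_psi_y[OF flow t]]) (unfold rq, rule Y, use t in simp)
    show "((\<lambda>s. (s * z s - 1) / (s - 1)) has_field_derivative
        - 1 * (- t * q * (?fz + 1 - z t) / (t * (t - 1)))) (at t)"
      by (rule DERIV_cong[OF derivative_psi_z[OF flow t(2)]])
        (use t in \<open>simp add: q_def divide_simps power2_eq_square\<close>)
    show "((\<lambda>s. (s - 1) * w s / s) has_field_derivative
        - 1 * (- (t - 1) * r * (?fw + w t) / (t * (t - 1)))) (at t)"
      by (rule DERIV_cong[OF derivative_psi_w[OF flow t(1)]])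
        (use t in \<open>simp add: r_def divide_simps power2_eq_square\<close>, simp add: algebra_simps)
  qed
qed

lemma baecklund_psi: "baecklund \<Psi>"
proof (rule baecklundI[where k = "(- 1)" and d = 1 and A = A_psi and R = "\<lambda>x y z w t. x \<noteq> t"
      and X = "\<lambda>\<alpha> x y z w t. (t - 1) * x / (t - x)" and Y =
      "\<lambda>\<alpha> x y z w t. (t - x) * ((t - x) * y - \<alpha> 2) / (t * (t - 1))"
      and Z = "\<lambda>\<alpha> x y z w t. (t * z - 1) / (t - 1)" and W = "\<lambda>\<alpha> x y z w t. (t - 1) * w / t"])
  show "field_automorphism \<Psi>"
    unfolding \<Psi>_def by (rule psi.field_automorphism_subst)
  show "\<Psi> ` set params \<subseteq> param_field"
    by (simp add: params_def psi_images param_field_intros)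
qed (simp, (rule psi_val psi_flow_at; assumption)+)

theorem theorem3p3:
  shows "\<exists>(w :: nat \<Rightarrow> ratfun \<Rightarrow> ratfun) (\<psi> :: ratfun \<Rightarrow> ratfun).
    images (w 0) =
      ([\<x>, \<y> - \<a>0 / (\<x> - \<t>), \<z>, \<w>, \<t>],
       [- \<a>0, \<a>1, \<a>2 + \<a>0, \<a>3, \<a>4, \<a>5, \<a>6]) \<and>
    images (w 1) =
      ([\<x>, \<y>, \<z>, \<w>, \<t>],
       [\<a>0, - \<a>1, \<a>2 + \<a>1, \<a>3, \<a>4, \<a>5, \<a>6]) \<and>
    images (w 2) =
      ([\<x> + \<a>2 / \<y>, \<y>, \<z>, \<w>, \<t>],
       [\<a>0 + \<a>2, \<a>1 + \<a>2, - \<a>2, \<a>3 + \<a>2, \<a>4, \<a>5, \<a>6]) \<and>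
    images (w 3) =
      ([\<x>, \<y> - \<a>3 * \<z> / (\<x> * \<z> - 1), \<z>, \<w> - \<a>3 * \<x> / (\<x> * \<z> - 1), \<t>],
       [\<a>0, \<a>1, \<a>2 + \<a>3, - \<a>3, \<a>4 + \<a>3, \<a>5, \<a>6]) \<and>
    images (w 4) =
      ([\<x>, \<y>, \<z> + \<a>4 / \<w>, \<w>, \<t>],
       [\<a>0, \<a>1, \<a>2, \<a>3 + \<a>4, - \<a>4, \<a>5 + \<a>4, \<a>6]) \<and>
    images (w 5) =
      ([\<x>, \<y>, \<z>, \<w>, \<t>],
       [\<a>0, \<a>1, \<a>2, \<a>3, \<a>4 + \<a>5, - \<a>5, \<a>6 + \<a>5]) \<and>
    images (w 6) =
      ([1 - \<x>, - \<y>, \<z> / (\<z> - 1), - ((\<z> - 1) * ((\<z> - 1) * \<w> + \<a>4)), 1 - \<t>],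
       [\<a>0, \<a>1, \<a>2, \<a>3, \<a>4, \<a>5 + 2 * \<a>6, - \<a>6]) \<and>
    images \<psi> =
      ([(\<t> - 1) * \<x> / (\<t> - \<x>),
        (\<t> - \<x>) * ((\<t> - \<x>) * \<y> - \<a>2) / (\<t> * (\<t> - 1)),
        (\<t> * \<z> - 1) / (\<t> - 1),
        (\<t> - 1) * \<w> / \<t>,
        1 - \<t>],
       [\<a>1, \<a>0, \<a>2, \<a>3, \<a>4, \<a>5, \<a>6]) \<and>
    (\<forall>i\<le>6. baecklund (w i)) \<and> baecklund \<psi> \<and>
    (\<forall>i\<le>6. w i \<circ> w i = id) \<and>
    (\<forall>i\<le>6. \<forall>j\<le>6. i \<noteq> j \<longrightarrow> (w i \<circ> w j) ^^ coxeter_B6 i j = id) \<and>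
    \<psi> \<circ> \<psi> = id \<and>
    \<psi> \<circ> w 0 \<circ> inv \<psi> = w 1 \<and>
    \<psi> \<circ> w 1 \<circ> inv \<psi> = w 0 \<and>
    (\<forall>i\<in>{2..6}. \<psi> \<circ> w i \<circ> inv \<psi> = w i)"
proof (rule exI[of _ "(!) [W0, W1, W2, W3, W4, W5, W6]"], rule exI[of _ \<Psi>], intro conjI)
  let ?w = "(!) [W0, W1, W2, W3, W4, W5, W6]"
  have w: "?w 0 = W0" "?w 1 = W1" "?w 2 = W2" "?w 3 = W3" "?w 4 = W4" "?w 5 = W5" "?w 6 = W6"
    by simp_all
  show "\<forall>i\<le>6. baecklund (?w i)"
    unfolding all_le_6 w by (intro conjI baecklund_w0 baecklund_w1 baecklund_w2 baecklund_w3
      baecklund_w4 baecklund_w5 baecklund_w6)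
  show "baecklund \<Psi>" by (rule baecklund_psi)
  show "\<forall>i\<le>6. ?w i \<circ> ?w i = id"
    unfolding all_le_6 w by (intro conjI W0_involution W1_involution W2_involution W3_involution
      W4_involution W5_involution W6_involution)
  show "\<forall>i\<le>6. \<forall>j\<le>6. i \<noteq> j \<longrightarrow> (?w i \<circ> ?w j) ^^ coxeter_B6 i j = id"
    \<comment> \<open>\<open>coxeter_B6\<close> is defined on unordered pairs while the claim ranges
      over ordered ones, hence both orders in \<open>coxeter_relations\<close>.\<close>
    unfolding all_le_6 w by (simp add: coxeter_B6_def doubleton_eq_iff coxeter_relations)
  show "\<Psi> \<circ> \<Psi> = id" by (rule \<Psi>_involution)
  show "\<Psi> \<circ> ?w 0 \<circ> inv \<Psi> = ?w 1" "\<Psi> \<circ> ?w 1 \<circ> inv \<Psi> = ?w 0"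
    unfolding w by (rule conj_psi, rule psi_comp_w0 psi_comp_w1)+
  show "\<forall>i\<in>{2..6}. \<Psi> \<circ> ?w i \<circ> inv \<Psi> = ?w i"
  proof
    fix i :: nat assume "i \<in> {2..6}"
    then have "i \<in> {2, 3, 4, 5, 6}" by auto
    then show "\<Psi> \<circ> ?w i \<circ> inv \<Psi> = ?w i"
      using psi_comp_w2 psi_comp_w3 psi_comp_w4 psi_comp_w5 psi_comp_w6 by (auto intro!: conj_psi)
  qed
qed (simp_all add: images_def params_def w0_images w1_images w2_images w3_images w4_images w5_images
    w6_images psi_images)

end
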